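(* Let $G$ be a finite group of order $|G|=p_1^{a_1}\cdots p_n^{a_n}$, with $p_1,\dots,p_n$ distinct primes. Let $r$ be the (torsion-free) rank of $G_{ab}$ and let $k$ be the number of cyclic groups of even order in the decomposition of $G_{ab}$ as a direct product of cyclic groups. Then $$|\pi_2^S(K(G,1))|\le 2^{r+k}\times\prod_{i=1}^n p_i^{\frac{a_i(a_i-1)}{2}}.$$
   Context: $G_{ab}$ is the abelianization of $G$ (so $r=0$ for finite $G$; $r$ and $k$ are read from a decomposition $G_{ab}\cong\mathbb{Z}^r\times\mathbb{Z}/n_1\mathbb{Z}\times\cdots\times\mathbb{Z}/n_m\mathbb{Z}$, $k$ being the number of even $n_i$). $K(G,1)$ is the Eilenberg–MacLane space, $S$ denotes suspension, and $\pi_2^S(K(G,1))=\pi_4(S^2K(G,1))$ is the second stable homotopy group. Algebraically (Brown–Loday): let $G\otimes G$ be the nonabelian tensor square, i.e. the group generated by symbols $g\otimes h$ ($g,h\in G$) with relations $gg'\otimes h=({}^gg'\otimes{}^gh)(g\otimes h)$ and $g\otimes hh'=(g\otimes h)({}^hg\otimes{}^hh')$, where ${}^gg'=gg'g^{-1}$; let $J(G)$ be the kernel of $G\otimes G\to G'$, $g\otimes h\mapsto[g,h]$, and $\Delta(G)$ the subgroup generated by all $(x\otimes y)(y\otimes x)$. Then $\pi_2^S(K(G,1))\cong J(G)/\Delta(G)$. *)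

theory Defs
  imports "HOL-Algebra.Product_Groups" "HOL-Algebra.Generated_Groups" "HOL-Algebra.Elementary_Groups" "HOL-Computational_Algebra.Primes"
begin

section \<open>Groups given by generators and relations\<close>

text \<open>A word is a list of signed letters: \<open>(x, True)\<close> stands for the generator \<open>x\<close> and
  \<open>(x, False)\<close> for its formal inverse. A relator set \<open>R\<close> consists of pairs \<open>(u, v)\<close> of words,
  read as the relation \<open>u = v\<close>.\<close>

type_synonym 'x word = "('x \<times> bool) list"

definition words :: "'x set \<Rightarrow> 'x word set" where
  "words X = lists (X \<times> UNIV)"

inductive_set word_rel :: "'x set \<Rightarrow> ('x word \<times> 'x word) set \<Rightarrow> ('x word \<times> 'x word) set"
  for X R where
  refl: "w \<in> words X \<Longrightarrow> (w, w) \<in> word_rel X R"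
| sym: "(u, v) \<in> word_rel X R \<Longrightarrow> (v, u) \<in> word_rel X R"
| trans: "(u, v) \<in> word_rel X R \<Longrightarrow> (v, w) \<in> word_rel X R \<Longrightarrow> (u, w) \<in> word_rel X R"
| append: "(u, v) \<in> word_rel X R \<Longrightarrow> (u', v') \<in> word_rel X R
    \<Longrightarrow> (u @ u', v @ v') \<in> word_rel X R"
| cancel: "x \<in> X \<Longrightarrow> ([(x, b), (x, \<not> b)], []) \<in> word_rel X R"
| relation: "(u, v) \<in> R \<Longrightarrow> u \<in> words X \<Longrightarrow> v \<in> words X \<Longrightarrow> (u, v) \<in> word_rel X R"

definition presented_group ::
    "'x set \<Rightarrow> ('x word \<times> 'x word) set \<Rightarrow> 'x word set monoid" where
  "presented_group X R = \<lparr>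
     carrier = words X // word_rel X R,
     monoid.mult = (\<lambda>A B. \<Union>u\<in>A. \<Union>v\<in>B. word_rel X R `` {u @ v}),
     one = word_rel X R `` {[]}\<rparr>"

definition presented_gen ::
    "'x set \<Rightarrow> ('x word \<times> 'x word) set \<Rightarrow> 'x \<Rightarrow> 'x word set" where
  "presented_gen X R x = word_rel X R `` {[(x, True)]}"

fun word_value :: "('a, 'b) monoid_scheme \<Rightarrow> ('x \<Rightarrow> 'a) \<Rightarrow> 'x word \<Rightarrow> 'a" where
  "word_value G f [] = \<one>\<^bsub>G\<^esub>"
| "word_value G f ((x, b) # w) =
     (if b then f x else inv\<^bsub>G\<^esub> (f x)) \<otimes>\<^bsub>G\<^esub> word_value G f w"

text \<open>The homomorphism out of a presented group extending a map \<open>f\<close> on generators. It is meaningful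
  when \<open>f\<close> respects the relations (see \<open>presented_lift_hom\<close> below): then all words of a class
  have the same value.\<close>

definition presented_lift ::
    "('a, 'b) monoid_scheme \<Rightarrow> ('x \<Rightarrow> 'a) \<Rightarrow> 'x word set \<Rightarrow> 'a" where
  "presented_lift G f A = the_elem (word_value G f ` A)"

lemma words_Nil [simp]: "[] \<in> words X"
  and words_Cons [simp]: "(x, b) # w \<in> words X \<longleftrightarrow> x \<in> X \<and> w \<in> words X"
  and words_append [simp]: "u @ v \<in> words X \<longleftrightarrow> u \<in> words X \<and> v \<in> words X"
  by (auto simp: words_def)

lemma word_rel_words:
  assumes "(u, v) \<in> word_rel X R" shows "u \<in> words X \<and> v \<in> words X"
  using assms by induction auto

lemma equiv_word_rel: "equiv (words X) (word_rel X R)"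
proof (rule equivI)
  show "word_rel X R \<subseteq> words X \<times> words X" using word_rel_words by auto
  show "refl_on (words X) (word_rel X R)"
    by (auto intro!: refl_onI word_rel.refl dest: word_rel_words)
  show "Relation.sym (word_rel X R)" by (rule symI) (rule word_rel.sym)
  show "Relation.trans (word_rel X R)" by (rule transI) (rule word_rel.trans)
qed

lemma presented_mult_class:
  assumes "u \<in> words X" "v \<in> words X"
  shows "(word_rel X R `` {u}) \<otimes>\<^bsub>presented_group X R\<^esub> (word_rel X R `` {v})
         = word_rel X R `` {u @ v}"
proof -
  let ?C = "\<lambda>w. word_rel X R `` {w}"
  have "?C (u' @ v') = ?C (u @ v)" if "u' \<in> ?C u" "v' \<in> ?C v" for u' v'
    using that equiv_class_eq[OF equiv_word_rel word_rel.append[of u u' X R v v']] by simp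
  then have "(\<Union>u'\<in>?C u. \<Union>v'\<in>?C v. ?C (u' @ v')) = (\<Union>u'\<in>?C u. \<Union>v'\<in>?C v. ?C (u @ v))"
    by (intro SUP_cong HOL.refl) blast
  also have "\<dots> = ?C (u @ v)"
    using word_rel.refl[OF assms(1), of R] word_rel.refl[OF assms(2), of R] by blast
  finally show ?thesis by (simp add: presented_group_def)
qed

lemma word_inverse_ex:
  assumes "w \<in> words X" shows "\<exists>v\<in>words X. (v @ w, []) \<in> word_rel X R"
  using assms
proof (induction w)
  case Nil
  then show ?case by (intro bexI[of _ "[]"]) (auto intro: word_rel.refl)
next
  case (Cons a w)
  obtain x b where a: "a = (x, b)" by (cases a)
  with Cons obtain v where v: "v \<in> words X" "(v @ w, []) \<in> word_rel X R" and x: "x \<in> X"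
    and w: "w \<in> words X" by auto
  have "([(x, \<not> b), (x, b)] @ w, [] @ w) \<in> word_rel X R"
    using word_rel.append[OF word_rel.cancel[OF x, of "\<not> b"] word_rel.refl[OF w]] by simp
  from word_rel.trans[OF word_rel.append[OF word_rel.refl[OF v(1)] this]] v(2)
  have "((v @ [(x, \<not> b)]) @ a # w, []) \<in> word_rel X R"
    by (simp add: a)
  then show ?case using v x by (intro bexI[of _ "v @ [(x, \<not> b)]"]) auto
qed

lemma group_presented_group: "group (presented_group X R)"
proof (rule groupI)
  let ?P = "presented_group X R"
  have car: "A \<in> carrier ?P \<longleftrightarrow> (\<exists>u\<in>words X. A = word_rel X R `` {u})" for A
    by (auto simp: presented_group_def quotient_def)
  have one: "\<one>\<^bsub>?P\<^esub> = word_rel X R `` {[]}" by (simp add: presented_group_def)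
  show "\<one>\<^bsub>?P\<^esub> \<in> carrier ?P" unfolding car one by (intro bexI[of _ "[]"]) auto
  fix A assume "A \<in> carrier ?P"
  then obtain u where u: "u \<in> words X" "A = word_rel X R `` {u}" unfolding car by auto
  show "\<one>\<^bsub>?P\<^esub> \<otimes>\<^bsub>?P\<^esub> A = A" using u by (simp add: one presented_mult_class)
  obtain v where v: "v \<in> words X" "(v @ u, []) \<in> word_rel X R"
    using word_inverse_ex[OF u(1)] by auto
  show "\<exists>B\<in>carrier ?P. B \<otimes>\<^bsub>?P\<^esub> A = \<one>\<^bsub>?P\<^esub>"
  proof (rule bexI)
    show "word_rel X R `` {v} \<in> carrier ?P" unfolding car using v by auto
    show "word_rel X R `` {v} \<otimes>\<^bsub>?P\<^esub> A = \<one>\<^bsub>?P\<^esub>"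
      using u v equiv_class_eq[OF equiv_word_rel v(2)] by (simp add: one presented_mult_class)
  qed
  fix B assume "B \<in> carrier ?P"
  then obtain v where v: "v \<in> words X" "B = word_rel X R `` {v}" unfolding car by auto
  show "A \<otimes>\<^bsub>?P\<^esub> B \<in> carrier ?P" unfolding car using u v
    by (intro bexI[of _ "u @ v"]) (auto simp: presented_mult_class)
  fix C assume "C \<in> carrier ?P"
  then obtain w where w: "w \<in> words X" "C = word_rel X R `` {w}" unfolding car by auto
  show "A \<otimes>\<^bsub>?P\<^esub> B \<otimes>\<^bsub>?P\<^esub> C = A \<otimes>\<^bsub>?P\<^esub> (B \<otimes>\<^bsub>?P\<^esub> C)"
    using u v w by (simp add: presented_mult_class)
qed

context group
begin

lemma word_value_closed:
  assumes "\<And>x. x \<in> X \<Longrightarrow> f x \<in> carrier G" "w \<in> words X"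
  shows "word_value G f w \<in> carrier G"
  using assms(2) by (induction w) (auto simp: assms(1))

lemma word_value_append:
  assumes "\<And>x. x \<in> X \<Longrightarrow> f x \<in> carrier G" "u \<in> words X" "v \<in> words X"
  shows "word_value G f (u @ v) = word_value G f u \<otimes> word_value G f v"
  using assms(2)
  by (induction u) (auto simp: assms(1) m_assoc word_value_closed[OF assms(1)] assms(3))

lemma word_value_respects:
  assumes f: "\<And>x. x \<in> X \<Longrightarrow> f x \<in> carrier G"
    and R: "\<And>u v. (u, v) \<in> R \<Longrightarrow> u \<in> words X \<Longrightarrow> v \<in> words X \<Longrightarrow> word_value G f u = word_value G f v"
    and uv: "(u, v) \<in> word_rel X R"
  shows "word_value G f u = word_value G f v"
  using uv
proof induction
  case (append u v u' v')
  then show ?case by (auto dest!: word_rel_words simp: word_value_append[of X, OF f])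
next
  case (cancel x b)
  then show ?case by (cases b) (auto simp: f)
next
  case (relation u v)
  then show ?case by (rule R)
qed simp_all

lemma presented_lift_class:
  assumes f: "\<And>x. x \<in> X \<Longrightarrow> f x \<in> carrier G"
    and R: "\<And>u v. (u, v) \<in> R \<Longrightarrow> u \<in> words X \<Longrightarrow> v \<in> words X \<Longrightarrow> word_value G f u = word_value G f v"
    and u: "u \<in> words X"
  shows "presented_lift G f (word_rel X R `` {u}) = word_value G f u"
proof -
  have "word_value G f ` (word_rel X R `` {u}) = {word_value G f u}"
  proof (intro equalityI subsetI)
    fix y assume "y \<in> word_value G f ` (word_rel X R `` {u})"
    then obtain v where "(u, v) \<in> word_rel X R" "y = word_value G f v" by blast
    then show "y \<in> {word_value G f u}" using word_value_respects[of X f R u v, OF f R] by simp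
  next
    fix y assume "y \<in> {word_value G f u}"
    then show "y \<in> word_value G f ` (word_rel X R `` {u})"
      using word_rel.refl[OF u, of R] by blast
  qed
  then show ?thesis by (simp add: presented_lift_def)
qed

lemma presented_lift_hom:
  assumes f: "\<And>x. x \<in> X \<Longrightarrow> f x \<in> carrier G"
    and R: "\<And>u v. (u, v) \<in> R \<Longrightarrow> u \<in> words X \<Longrightarrow> v \<in> words X \<Longrightarrow> word_value G f u = word_value G f v"
  shows "presented_lift G f \<in> hom (presented_group X R) G"
proof -
  have "carrier (presented_group X R) = (\<lambda>u. word_rel X R `` {u}) ` words X"
    by (auto simp: presented_group_def quotient_def)
  then show ?thesis
    by (auto simp: hom_def presented_mult_class presented_lift_class[of X f R, OF f R]
        word_value_closed[of X, OF f] word_value_append[of X, OF f])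
qed

end

section \<open>The nonabelian tensor square\<close>

definition conj_by :: "('a, 'b) monoid_scheme \<Rightarrow> 'a \<Rightarrow> 'a \<Rightarrow> 'a" where
  "conj_by G g h = g \<otimes>\<^bsub>G\<^esub> h \<otimes>\<^bsub>G\<^esub> inv\<^bsub>G\<^esub> g"

definition commutator :: "('a, 'b) monoid_scheme \<Rightarrow> 'a \<Rightarrow> 'a \<Rightarrow> 'a" where
  "commutator G g h = g \<otimes>\<^bsub>G\<^esub> h \<otimes>\<^bsub>G\<^esub> inv\<^bsub>G\<^esub> g \<otimes>\<^bsub>G\<^esub> inv\<^bsub>G\<^esub> h"

definition tensor_relations ::
    "('a, 'b) monoid_scheme \<Rightarrow> (('a \<times> 'a) word \<times> ('a \<times> 'a) word) set" where
  "tensor_relations G =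
     {([((g \<otimes>\<^bsub>G\<^esub> g', h), True)], [((conj_by G g g', conj_by G g h), True), ((g, h), True)])
       | g g' h. g \<in> carrier G \<and> g' \<in> carrier G \<and> h \<in> carrier G}
   \<union> {([((g, h \<otimes>\<^bsub>G\<^esub> h'), True)], [((g, h), True), ((conj_by G h g, conj_by G h h'), True)])
       | g h h'. g \<in> carrier G \<and> h \<in> carrier G \<and> h' \<in> carrier G}"

definition tensor_square :: "('a, 'b) monoid_scheme \<Rightarrow> ('a \<times> 'a) word set monoid" where
  "tensor_square G = presented_group (carrier G \<times> carrier G) (tensor_relations G)"

definition tensor :: "('a, 'b) monoid_scheme \<Rightarrow> 'a \<Rightarrow> 'a \<Rightarrow> ('a \<times> 'a) word set" where
  "tensor G g h = presented_gen (carrier G \<times> carrier G) (tensor_relations G) (g, h)"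

text \<open>The homomorphism from the tensor square to the derived subgroup sending \<open>tensor G g h\<close> to the
  commutator of \<open>g\<close> and \<open>h\<close>.\<close>

definition tensor_commutator :: "('a, 'b) monoid_scheme \<Rightarrow> ('a \<times> 'a) word set \<Rightarrow> 'a" where
  "tensor_commutator G = presented_lift G (\<lambda>(g, h). commutator G g h)"

definition tensor_J :: "('a, 'b) monoid_scheme \<Rightarrow> ('a \<times> 'a) word set set" where
  "tensor_J G = kernel (tensor_square G) G (tensor_commutator G)"

definition tensor_Delta :: "('a, 'b) monoid_scheme \<Rightarrow> ('a \<times> 'a) word set set" where
  "tensor_Delta G = generate (tensor_square G)
     {tensor G x y \<otimes>\<^bsub>tensor_square G\<^esub> tensor G y x | x y. x \<in> carrier G \<and> y \<in> carrier G}"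

text \<open>The second stable homotopy group of the Eilenberg--MacLane space \<open>K(G,1)\<close>, in the algebraic
  form \<open>J(G) / \<Delta>(G)\<close> due to Brown and Loday.\<close>

definition pi2_stable_K1 :: "('a, 'b) monoid_scheme \<Rightarrow> ('a \<times> 'a) word set set monoid" where
  "pi2_stable_K1 G = (tensor_square G)\<lparr>carrier := tensor_J G\<rparr> Mod tensor_Delta G"

context group
begin

lemma group_tensor_square: "group (tensor_square G)"
  by (simp add: tensor_square_def group_presented_group)

lemma commutator_closed:
  "g \<in> carrier G \<Longrightarrow> h \<in> carrier G \<Longrightarrow> commutator G g h \<in> carrier G"
  by (simp add: commutator_def)

lemma commutator_respects_tensor_relations:
  assumes "(u, v) \<in> tensor_relations G"
  shows "word_value G (\<lambda>(g, h). commutator G g h) u = word_value G (\<lambda>(g, h). commutator G g h) v"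
proof -
  have c: "inv a \<otimes> (a \<otimes> b) = b" "a \<otimes> (inv a \<otimes> b) = b"
    if "a \<in> carrier G" "b \<in> carrier G" for a b
    using that by (auto simp flip: m_assoc)
  show ?thesis
    using assms unfolding tensor_relations_def
    by (auto simp: commutator_def conj_by_def m_assoc inv_mult_group c)
qed

lemma tensor_commutator_hom: "tensor_commutator G \<in> hom (tensor_square G) G"
  unfolding tensor_commutator_def tensor_square_def
  by (rule presented_lift_hom)
    (auto simp: commutator_closed intro: commutator_respects_tensor_relations)

lemma tensor_commutator_tensor:
  assumes "g \<in> carrier G" "h \<in> carrier G"
  shows "tensor_commutator G (tensor G g h) = commutator G g h"
proof -
  have "tensor_commutator G (tensor G g h)
      = word_value G (\<lambda>(g, h). commutator G g h) [((g, h), True)]"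
    unfolding tensor_commutator_def tensor_def presented_gen_def
    by (rule presented_lift_class)
      (use assms in \<open>auto simp: commutator_closed intro: commutator_respects_tensor_relations\<close>)
  then show ?thesis using assms by (simp add: commutator_closed)
qed

end

section \<open>Abelianization\<close>

definition abelianization :: "('a, 'b) monoid_scheme \<Rightarrow> 'a set monoid" where
  "abelianization G = G Mod derived G (carrier G)"

end

theory Submission
  imports Defs "HOL-Algebra.Group_Action" "HOL-Algebra.Sylow" "HOL-Algebra.Multiplicative_Group"
begin

text \<open>Modulo \<open>\<Delta>(G)\<close> the diagonal \<open>x \<mapsto> x \<otimes> x\<close> becomes a homomorphism from \<open>G\<close> with central image of
  exponent two, so its image has at most \<open>2 ^ (r + k)\<close> elements. Dividing it out as well turns the
  tensor square into the exterior square \<open>G \<and> G\<close>, and it remains to bound the Schur multiplier, the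
  kernel of \<open>G \<and> G \<rightarrow> G\<close>.

  The exterior square is embedded in a group \<open>E\<close> over \<open>G\<close> in which the commutator of \<open>x\<close> and \<open>y\<close> is
  the pairing of their images in \<open>G\<close>. For a Sylow subgroup \<open>P\<close>, the transfer from \<open>E\<close> to the preimage
  of \<open>P\<close> shows that the \<open>[G : P]\<close>-th power of an element of the kernel lies in the image of \<open>P \<and> P\<close>.
  The indices of the Sylow subgroups being coprime, the kernel embeds into the product of these
  images. Finally, if \<open>|P| = p ^ a\<close>, an ascending central series of \<open>P\<close> bounds the image of \<open>P \<and> P\<close>:
  if \<open>z\<close> is central modulo \<open>N\<close>, then modulo \<open>N \<and> P\<close> the map \<open>g \<mapsto> z \<and> g\<close> is a homomorphism killing
  \<open>N\<close> and \<open>z\<close>.\<close>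

section \<open>Crossed pairings\<close>

context group
begin

lemma conj_by_closed [simp]:
  "g \<in> carrier G \<Longrightarrow> x \<in> carrier G \<Longrightarrow> conj_by G g x \<in> carrier G"
  by (simp add: conj_by_def)

lemma conj_by_one_left [simp]: "x \<in> carrier G \<Longrightarrow> conj_by G \<one> x = x"
  by (simp add: conj_by_def)

lemma conj_by_one_right [simp]: "g \<in> carrier G \<Longrightarrow> conj_by G g \<one> = \<one>"
  by (simp add: conj_by_def)

lemma inv_mult_cancel:
  assumes "a \<in> carrier G" "b \<in> carrier G"
  shows "inv a \<otimes> (a \<otimes> b) = b" "a \<otimes> (inv a \<otimes> b) = b"
  using assms by (simp_all flip: m_assoc)

lemma conj_by_mult_left:
  "\<lbrakk>g \<in> carrier G; h \<in> carrier G; x \<in> carrier G\<rbrakk>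
    \<Longrightarrow> conj_by G (g \<otimes> h) x = conj_by G g (conj_by G h x)"
  by (simp add: conj_by_def m_assoc inv_mult_group)

lemma conj_by_mult_right:
  "\<lbrakk>g \<in> carrier G; x \<in> carrier G; y \<in> carrier G\<rbrakk>
    \<Longrightarrow> conj_by G g (x \<otimes> y) = conj_by G g x \<otimes> conj_by G g y"
  by (simp add: conj_by_def m_assoc inv_mult_cancel)

lemma conj_by_inv:
  "\<lbrakk>g \<in> carrier G; x \<in> carrier G\<rbrakk> \<Longrightarrow> conj_by G g (inv x) = inv (conj_by G g x)"
  by (simp add: conj_by_def m_assoc inv_mult_group)

lemma conj_by_self [simp]: "x \<in> carrier G \<Longrightarrow> conj_by G x x = x"
  by (simp add: conj_by_def m_assoc)

lemma conj_by_conj_by: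
  "\<lbrakk>g \<in> carrier G; h \<in> carrier G; x \<in> carrier G\<rbrakk>
    \<Longrightarrow> conj_by G (conj_by G g h) (conj_by G g x) = conj_by G g (conj_by G h x)"
  by (simp add: conj_by_def m_assoc inv_mult_group inv_mult_cancel)

lemma conj_by_cancel [simp]:
  assumes "g \<in> carrier G" "x \<in> carrier G"
  shows "conj_by G (inv g) (conj_by G g x) = x" "conj_by G g (conj_by G (inv g) x) = x"
  using assms by (simp_all flip: conj_by_mult_left)

lemma commutator_eq:
  "\<lbrakk>g \<in> carrier G; h \<in> carrier G\<rbrakk> \<Longrightarrow> commutator G g h = g \<otimes> conj_by G h (inv g)"
  "\<lbrakk>g \<in> carrier G; h \<in> carrier G\<rbrakk> \<Longrightarrow> commutator G g h = conj_by G g h \<otimes> inv h"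
  by (simp_all add: conj_by_def commutator_def m_assoc)

lemma commutator_mult:
  "\<lbrakk>g \<in> carrier G; h \<in> carrier G\<rbrakk> \<Longrightarrow> commutator G g h \<otimes> (h \<otimes> g) = g \<otimes> h"
  by (simp add: commutator_def m_assoc inv_mult_cancel)

lemma commutator_self_inverse:
  "\<lbrakk>g \<in> carrier G; h \<in> carrier G\<rbrakk> \<Longrightarrow> inv (commutator G g h) = commutator G h g"
  by (simp add: commutator_def m_assoc inv_mult_group)

lemma conj_by_eq_iff_commute:
  "\<lbrakk>g \<in> carrier G; x \<in> carrier G\<rbrakk> \<Longrightarrow> conj_by G g x = x \<longleftrightarrow> g \<otimes> x = x \<otimes> g"
  by (metis conj_by_def inv_solve_right' m_closed)

lemma commutator_in_normal_swap:
  assumes "N \<lhd> G" "g \<in> carrier G" "z \<in> carrier G" "commutator G g z \<in> N"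
  shows "commutator G z g \<in> N"
  using assms by (metis commutator_self_inverse normal_imp_subgroup subgroup.m_inv_closed)

end

text \<open>The two laws are the defining relations of the nonabelian tensor square, so
  \<open>w\<close> amounts to a homomorphism from it to \<open>L\<close>. Keeping \<open>L\<close>
  abstract lets one argument serve the tensor square, its quotients, and restrictions to subgroups
  of \<open>G\<close>.\<close>

locale crossed_pairing = G: group G + L: group L
  for G :: "('a, 'b) monoid_scheme" and L :: "('c, 'd) monoid_scheme" +
  fixes w :: "'a \<Rightarrow> 'a \<Rightarrow> 'c"
  assumes w_closed [simp]: "\<lbrakk>g \<in> carrier G; h \<in> carrier G\<rbrakk> \<Longrightarrow> w g h \<in> carrier L"
    and w_mult_left: "\<lbrakk>g \<in> carrier G; g' \<in> carrier G; h \<in> carrier G\<rbrakk>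
      \<Longrightarrow> w (g \<otimes>\<^bsub>G\<^esub> g') h = w (conj_by G g g') (conj_by G g h) \<otimes>\<^bsub>L\<^esub> w g h"
    and w_mult_right: "\<lbrakk>g \<in> carrier G; h \<in> carrier G; h' \<in> carrier G\<rbrakk>
      \<Longrightarrow> w g (h \<otimes>\<^bsub>G\<^esub> h') = w g h \<otimes>\<^bsub>L\<^esub> w (conj_by G h g) (conj_by G h h')"
begin

lemma w_one_left [simp]: "h \<in> carrier G \<Longrightarrow> w \<one>\<^bsub>G\<^esub> h = \<one>\<^bsub>L\<^esub>"
  using w_mult_left[of "\<one>\<^bsub>G\<^esub>" "\<one>\<^bsub>G\<^esub>" h] by (simp add: L.l_cancel_one')

lemma w_one_right [simp]: "g \<in> carrier G \<Longrightarrow> w g \<one>\<^bsub>G\<^esub> = \<one>\<^bsub>L\<^esub>"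
  using w_mult_right[of g "\<one>\<^bsub>G\<^esub>" "\<one>\<^bsub>G\<^esub>"] by (simp add: L.l_cancel_one')

text \<open>Both sides arise by expanding \<open>w (m \<otimes> a) (n \<otimes> b)\<close> in the two possible orders.\<close>

lemma w_conj_w:
  assumes m: "m \<in> carrier G" and n: "n \<in> carrier G" and a: "a \<in> carrier G" and b: "b \<in> carrier G"
  shows "w m n \<otimes>\<^bsub>L\<^esub> w (conj_by G n (conj_by G m a)) (conj_by G n (conj_by G m b))
       = w (conj_by G m (conj_by G n a)) (conj_by G m (conj_by G n b)) \<otimes>\<^bsub>L\<^esub> w m n"
proof -
  let ?c = "conj_by G"
  have "w (m \<otimes>\<^bsub>G\<^esub> a) (n \<otimes>\<^bsub>G\<^esub> b)
      = w (?c m a) (?c m n) \<otimes>\<^bsub>L\<^esub> (w (?c m (?c n a)) (?c m (?c n b)) \<otimes>\<^bsub>L\<^esub> w m n) \<otimes>\<^bsub>L\<^esub> w (?c n m) (?c n b)"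
    using assms
    by (subst w_mult_left) (simp_all add: w_mult_right G.conj_by_mult_right G.conj_by_conj_by L.m_assoc)
  moreover have "w (m \<otimes>\<^bsub>G\<^esub> a) (n \<otimes>\<^bsub>G\<^esub> b)
      = w (?c m a) (?c m n) \<otimes>\<^bsub>L\<^esub> (w m n \<otimes>\<^bsub>L\<^esub> w (?c n (?c m a)) (?c n (?c m b))) \<otimes>\<^bsub>L\<^esub> w (?c n m) (?c n b)"
    using assms
    by (subst w_mult_right) (simp_all add: w_mult_left G.conj_by_mult_right G.conj_by_conj_by L.m_assoc)
  ultimately show ?thesis
    using assms by simp
qed

text \<open>Conjugating \<open>a\<close> and \<open>b\<close> first by the inverse of n m turns the
  left side of \<open>w_conj_w\<close> into \<open>w m n\<close> times \<open>w a b\<close>, while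
  the right side acquires the action of m n (n m)^-1, which is the commutator.\<close>

lemma w_conj:
  assumes m: "m \<in> carrier G" and n: "n \<in> carrier G" and a: "a \<in> carrier G" and b: "b \<in> carrier G"
  shows "conj_by L (w m n) (w a b)
       = w (conj_by G (commutator G m n) a) (conj_by G (commutator G m n) b)"
proof -
  define k where "k = inv\<^bsub>G\<^esub> (n \<otimes>\<^bsub>G\<^esub> m)"
  have k: "k \<in> carrier G" using m n by (simp add: k_def)
  have 1: "conj_by G n (conj_by G m (conj_by G k x)) = x" if "x \<in> carrier G" for x
    using that m n k
    by (simp add: G.inv_mult_cancel G.inv_mult_group k_def G.m_assoc flip: G.conj_by_mult_left)
  have 2: "conj_by G m (conj_by G n (conj_by G k x)) = conj_by G (commutator G m n) x"
    if "x \<in> carrier G" for x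
    using that m n k
    by (simp add: k_def commutator_def G.m_assoc G.inv_mult_group flip: G.conj_by_mult_left)
  show ?thesis
    using w_conj_w[OF m n, of "conj_by G k a" "conj_by G k b"] m n a b k
    by (simp add: 1 2 conj_by_def[of L] G.commutator_closed L.m_assoc)
qed

text \<open>Expanding along [m,n] = m (n m^-1 n^-1) by \<open>w_mult_left\<close> leaves a factor
  with a conjugate of m^-1 in the first argument. \<open>w_conj_w\<close> at m^-1, together with the
  triviality of \<open>w\<close> at m m^-1, expresses it through \<open>w m n\<close>.\<close>

lemma w_commutator_left:
  assumes m: "m \<in> carrier G" and n: "n \<in> carrier G" and k: "k \<in> carrier G"
  shows "w (commutator G m n) k = w m n \<otimes>\<^bsub>L\<^esub> inv\<^bsub>L\<^esub> w (conj_by G k m) (conj_by G k n)"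
proof -
  let ?c = "conj_by G"
  \<comment> \<open>The choice gives n k' = k n, so that \<open>w m\<close> at this element can be
    expanded along either factorization.\<close>
  define k' where "k' = ?c (inv\<^bsub>G\<^esub> n) k"
  have k': "k' \<in> carrier G" "?c n k' = k" "n \<otimes>\<^bsub>G\<^esub> k' = k \<otimes>\<^bsub>G\<^esub> n"
    using n k by (simp_all add: k'_def conj_by_def G.m_assoc G.inv_mult_cancel)
  let ?i = "inv\<^bsub>G\<^esub> m"
  have 1: "w (?c n (?c m ?i)) (?c n (?c m k')) = inv\<^bsub>L\<^esub> w (?c n m) k"
  proof -
    have "w (?c n m \<otimes>\<^bsub>G\<^esub> ?c n ?i) (?c n k') = \<one>\<^bsub>L\<^esub>"
      using m n k k' by (simp flip: G.conj_by_mult_right)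
    then have "w (?c n (?c m ?i)) (?c n (?c m k')) \<otimes>\<^bsub>L\<^esub> w (?c n m) (?c n k') = \<one>\<^bsub>L\<^esub>"
      using m n k'(1) by (subst (asm) w_mult_left) (simp_all add: G.conj_by_conj_by)
    then show ?thesis
      using m n k k' by (simp add: L.inv_equality)
  qed
  have 2: "w (?c m (?c n ?i)) (?c m k) = w m n \<otimes>\<^bsub>L\<^esub> inv\<^bsub>L\<^esub> w (?c n m) k \<otimes>\<^bsub>L\<^esub> inv\<^bsub>L\<^esub> w m n"
    using w_conj_w[OF m n, of ?i k'] m n k k' unfolding 1 by (simp add: L.inv_solve_right)
  have "w m n \<otimes>\<^bsub>L\<^esub> w (?c n m) k = w m k \<otimes>\<^bsub>L\<^esub> w (?c k m) (?c k n)"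
    using w_mult_right[of m n k'] w_mult_right[of m k n] m n k k' by simp
  then have "inv\<^bsub>L\<^esub> w (?c n m) k \<otimes>\<^bsub>L\<^esub> inv\<^bsub>L\<^esub> w m n
      = inv\<^bsub>L\<^esub> w (?c k m) (?c k n) \<otimes>\<^bsub>L\<^esub> inv\<^bsub>L\<^esub> w m k"
    using m n k by (simp flip: L.inv_mult_group)
  then have "w (?c m (?c n ?i)) (?c m k)
      = w m n \<otimes>\<^bsub>L\<^esub> (inv\<^bsub>L\<^esub> w (?c k m) (?c k n) \<otimes>\<^bsub>L\<^esub> inv\<^bsub>L\<^esub> w m k)"
    using 2 m n k by (simp add: L.m_assoc)
  then show ?thesis
    using m n k by (simp add: G.commutator_eq(1) w_mult_left L.m_assoc)
qed

text \<open>In \<open>w_commutator_left\<close> with \<open>m = n = x\<close> the left side is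
  trivial, so \<open>w x x\<close> equals its conjugate.\<close>

lemma w_diagonal_conj:
  assumes "x \<in> carrier G" "g \<in> carrier G"
  shows "w (conj_by G g x) (conj_by G g x) = w x x"
  using w_commutator_left[of x x g] assms
  by (metis G.commutator_mult G.conj_by_closed G.m_closed G.r_cancel_one' L.inv_equality L.inv_inv
      G.commutator_closed w_closed w_one_left L.inv_closed)

lemma crossed_pairing_subgroup:
  assumes "subgroup H G"
  shows "crossed_pairing (G\<lparr>carrier := H\<rparr>) L w"
proof -
  interpret H: subgroup H G by fact
  have "conj_by (G\<lparr>carrier := H\<rparr>) g x = conj_by G g x" if "g \<in> H" for g x
    using that by (simp add: conj_by_def G.m_inv_consistent[OF assms])
  then show ?thesis
    by (intro crossed_pairing.intro crossed_pairing_axioms.intro L.group_axioms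
        H.subgroup_is_group[OF G.group_axioms])
      (simp_all add: w_mult_left w_mult_right)
qed

lemma w_antisymmetric:
  assumes "\<And>x. x \<in> carrier G \<Longrightarrow> w x x = \<one>\<^bsub>L\<^esub>" and a: "a \<in> carrier G" and b: "b \<in> carrier G"
  shows "w b a \<otimes>\<^bsub>L\<^esub> w a b = \<one>\<^bsub>L\<^esub>"
proof -
  \<comment> \<open>Since a times \<open>?y\<close> is b a, pairing this element with itself
    produces diagonal values, which are trivial, and the cross terms \<open>w b a\<close> and
    \<open>w a b\<close>.\<close>
  let ?y = "conj_by G (inv\<^bsub>G\<^esub> a) b"
  have y: "?y \<in> carrier G" "conj_by G a ?y = b" using a b by simp_all
  have "w (a \<otimes>\<^bsub>G\<^esub> ?y) (a \<otimes>\<^bsub>G\<^esub> ?y) = w b (a \<otimes>\<^bsub>G\<^esub> b) \<otimes>\<^bsub>L\<^esub> w a (a \<otimes>\<^bsub>G\<^esub> ?y)"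
    using a b y(1) by (subst w_mult_left) (simp_all add: G.conj_by_mult_right)
  also have "\<dots> = w b a \<otimes>\<^bsub>L\<^esub> w (conj_by G a b) (conj_by G a b) \<otimes>\<^bsub>L\<^esub> (w a a \<otimes>\<^bsub>L\<^esub> w a b)"
    using a b y(1) by (simp add: w_mult_right)
  finally show ?thesis using a b y(1) by (simp add: assms(1))
qed

lemma crossed_pairing_quotient:
  assumes "H \<lhd> L"
  shows "crossed_pairing G (L Mod H) (\<lambda>g h. H #>\<^bsub>L\<^esub> w g h)"
proof -
  interpret H: normal H L by fact
  interpret Q: group "L Mod H" by (rule H.factorgroup_is_group)
  show ?thesis
    by unfold_locales
      (simp_all add: w_mult_left w_mult_right H.rcos_sum carrier_FactGroup)
qed

lemma crossed_pairing_image: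
  assumes "subgroup K L" and "\<And>g h. g \<in> carrier G \<Longrightarrow> h \<in> carrier G \<Longrightarrow> w g h \<in> K"
  shows "crossed_pairing G (L\<lparr>carrier := K\<rparr>) w"
proof -
  interpret K: subgroup K L by fact
  show ?thesis
    by (intro crossed_pairing.intro crossed_pairing_axioms.intro G.group_axioms
        K.subgroup_is_group[OF L.group_axioms])
      (simp_all add: w_mult_left w_mult_right assms(2))
qed

end

locale alternating_pairing = crossed_pairing +
  assumes w_self [simp]: "x \<in> carrier G \<Longrightarrow> w x x = \<one>\<^bsub>L\<^esub>"
begin

lemma w_swap: "a \<in> carrier G \<Longrightarrow> b \<in> carrier G \<Longrightarrow> w b a = inv\<^bsub>L\<^esub> w a b"
  by (metis L.inv_equality w_antisymmetric w_closed w_self)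

lemma inv_w: "a \<in> carrier G \<Longrightarrow> b \<in> carrier G \<Longrightarrow> inv\<^bsub>L\<^esub> w a b = w b a"
  by (rule w_swap[symmetric])

text \<open>For fixed \<open>b\<close>, the elements that commute with \<open>b\<close> and pair
  trivially with it form a subgroup. This is used first with \<open>b = g\<close> and then, after a
  swap, with \<open>b\<close> a power of \<open>g\<close>.\<close>

lemma w_cyclic:
  assumes g: "g \<in> carrier G"
  shows "w (g [^]\<^bsub>G\<^esub> (i::int)) (g [^]\<^bsub>G\<^esub> (j::int)) = \<one>\<^bsub>L\<^esub>"
proof -
  let ?S = "\<lambda>b. {x \<in> carrier G. x \<otimes>\<^bsub>G\<^esub> b = b \<otimes>\<^bsub>G\<^esub> x \<and> w x b = \<one>\<^bsub>L\<^esub>}"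
  have sub: "subgroup (?S b) G" if b: "b \<in> carrier G" for b
  proof (rule G.subgroupI)
    fix x assume x: "x \<in> ?S b"
    then have c: "conj_by G x b = b" using b by (simp add: G.conj_by_eq_iff_commute)
    then have c': "conj_by G (inv\<^bsub>G\<^esub> x) b = b"
      using x b by (metis (no_types, lifting) G.conj_by_cancel(1) mem_Collect_eq)
    have "w (inv\<^bsub>G\<^esub> x \<otimes>\<^bsub>G\<^esub> x) b = w (conj_by G (inv\<^bsub>G\<^esub> x) x) b \<otimes>\<^bsub>L\<^esub> w (inv\<^bsub>G\<^esub> x) b"
      using x b c' by (subst w_mult_left) simp_all
    moreover have "conj_by G (inv\<^bsub>G\<^esub> x) x = x"
      using x by (simp add: conj_by_def G.m_assoc)
    ultimately show "inv\<^bsub>G\<^esub> x \<in> ?S b"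
      using x b c' by (simp flip: G.conj_by_eq_iff_commute)
    fix y assume y: "y \<in> ?S b"
    then have "conj_by G y b = b" using b by (simp add: G.conj_by_eq_iff_commute)
    then have "conj_by G (x \<otimes>\<^bsub>G\<^esub> y) b = b" using c x y b by (simp add: G.conj_by_mult_left)
    moreover have "w (conj_by G x y) b = \<one>\<^bsub>L\<^esub>"
    proof -
      \<comment> \<open>Since \<open>y\<close> commutes with \<open>b\<close>, the left side is
        trivial, so conjugating both arguments by \<open>x\<close> does not change the trivial value
        \<open>w y b\<close>.\<close>
      have "w (commutator G y b) x = w y b \<otimes>\<^bsub>L\<^esub> inv\<^bsub>L\<^esub> w (conj_by G x y) (conj_by G x b)"
        using x y b by (simp add: w_commutator_left)
      moreover have "commutator G y b = \<one>\<^bsub>G\<^esub>"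
        using y b \<open>conj_by G y b = b\<close> by (simp add: G.commutator_eq(2))
      ultimately have "inv\<^bsub>L\<^esub> w (conj_by G x y) b = \<one>\<^bsub>L\<^esub>"
        using x y b by (simp add: c)
      then show ?thesis
        using x y b by (simp add: L.inv_eq_1_iff)
    qed
    ultimately show "x \<otimes>\<^bsub>G\<^esub> y \<in> ?S b"
      using x y b by (simp add: w_mult_left c flip: G.conj_by_eq_iff_commute)
  qed (use b in auto)
  have 1: "w (g [^]\<^bsub>G\<^esub> i) g = \<one>\<^bsub>L\<^esub>" for i :: int
    using G.subgroup_int_pow_closed[OF sub[OF g], of g i] g by simp
  have "g \<in> ?S (g [^]\<^bsub>G\<^esub> j)"
    using 1[of j] w_swap[of "g [^]\<^bsub>G\<^esub> j" g] g G.int_pow_mult[of g 1 j] G.int_pow_mult[of g j 1]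
    by (simp add: add.commute)
  then show ?thesis
    using G.subgroup_int_pow_closed[OF sub, of "g [^]\<^bsub>G\<^esub> j" g i] g by simp
qed

end

section \<open>Pairings on groups of prime power order\<close>

context group
begin

text \<open>Class equation: without a nontrivial central element the class of \<open>\<one>\<close>
  would be the only one of size 1 and all others would have size divisible by \<open>p\<close>, so
  \<open>p ^ n\<close> would be 1 modulo \<open>p\<close>.\<close>

lemma prime_power_order_center:
  assumes p: "Factorial_Ring.prime (p::nat)" and ord: "order G = p ^ n" and n: "n > 0"
  shows "\<exists>z\<in>carrier G. z \<noteq> \<one> \<and> (\<forall>g\<in>carrier G. g \<otimes> z = z \<otimes> g)"
proof (rule ccontr)
  assume no: "\<not> ?thesis"
  let ?\<phi> = "\<lambda>g. \<lambda>h\<in>carrier G. g \<otimes> h \<otimes> inv g"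
  interpret A: group_action G "carrier G" ?\<phi> by (rule action_by_conjugation)
  let ?O = "orbits G (carrier G) ?\<phi>"
  have fin: "finite (carrier G)"
    using ord prime_gt_0_nat[OF p] by (simp flip: order_gt_0_iff_finite)
  have finO: "finite ?O"
  proof (rule finite_UnionD)
    show "finite (\<Union>?O)" using fin by (simp only: A.orbits_coverture)
  qed
  have one: "{\<one>} \<in> ?O"
  proof -
    have "orbit G ?\<phi> \<one> = {\<one>}" by (auto simp: orbit_def intro!: exI[of _ \<one>])
    then show ?thesis by (auto simp: orbits_def intro: exI[of _ \<one>])
  qed
  have dvd: "p dvd card X" if X: "X \<in> ?O - {{\<one>}}" for X
  proof -
    obtain x where x: "x \<in> carrier G" "X = orbit G ?\<phi> x" using X by (auto simp: orbits_def)
    have "card X dvd p ^ n"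
      unfolding x(2) ord[symmetric] A.orbit_stabilizer_theorem[OF x(1), symmetric] by (rule dvd_triv_left)
    then obtain k where k: "card X = p ^ k" using p by (auto simp: divides_primepow_nat)
    have "card X \<noteq> 1"
    proof
      assume "card X = 1"
      then obtain y where y: "X = {y}" by (auto simp: card_1_singleton_iff)
      have "?\<phi> g x \<in> X" if "g \<in> carrier G" for g using that x by (auto simp: orbit_def)
      then have *: "g \<otimes> x \<otimes> inv g = y" if "g \<in> carrier G" for g using that x y by auto
      from *[of \<one>] have "y = x" using x by simp
      then have "g \<otimes> x = x \<otimes> g" if "g \<in> carrier G" for g
        using *[OF that] that x by (metis inv_solve_right' m_closed)
      with no x(1) have "x = \<one>" by blast
      with X y \<open>y = x\<close> show False by simp
    qed
    with k have "k > 0" by (cases k) auto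
    with k show ?thesis by simp
  qed
  have "(\<Sum>X\<in>?O. card X) = p ^ n"
    using A.disjoint_sum[OF fin, of "\<lambda>_. 1::nat"] ord by (simp add: order_def)
  then have eq: "1 + (\<Sum>X\<in>?O - {{\<one>}}. card X) = p ^ n"
    using sum.remove[OF finO one, of card] by simp
  have "p dvd (\<Sum>X\<in>?O - {{\<one>}}. card X)"
    using dvd by (rule dvd_sum)
  moreover have "p dvd 1 + (\<Sum>X\<in>?O - {{\<one>}}. card X)" unfolding eq using n by simp
  ultimately have "p dvd 1" using dvd_add_left_iff by blast
  then show False using p by simp
qed

text \<open>A nontrivial central element of \<open>G Mod N\<close>, again a group of
  \<open>p\<close>-power order, is lifted to \<open>G\<close>.\<close>

lemma prime_power_order_central_modulo:
  assumes p: "Factorial_Ring.prime (p::nat)" and ord: "order G = p ^ n"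
    and N: "N \<lhd> G" and proper: "N \<noteq> carrier G"
  shows "\<exists>z\<in>carrier G - N. \<forall>g\<in>carrier G. commutator G g z \<in> N"
proof -
  interpret N: normal N G by fact
  interpret Q: group "G Mod N" by (rule N.factorgroup_is_group)
  have fin: "finite (carrier G)"
    using ord prime_gt_0_nat[OF p] by (simp flip: order_gt_0_iff_finite)
  have "card (rcosets N) * card N = p ^ n" using lagrange[OF N.subgroup_axioms] ord by simp
  then have "order (G Mod N) dvd p ^ n" by (simp add: order_def FactGroup_def) (metis dvd_triv_left)
  then obtain k where k: "order (G Mod N) = p ^ k" using p by (auto simp: divides_primepow_nat)
  have "k > 0"
  proof (rule ccontr)
    assume "\<not> k > 0"
    with k have "carrier (G Mod N) = {N}" using Q.order_one_triv_iff by simp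
    then have "N #> x = N" if "x \<in> carrier G" for x using that by (auto simp: carrier_FactGroup)
    then have "carrier G \<subseteq> N" by (metis N.subgroup_axioms rcos_self subsetI)
    with proper N.subset show False by blast
  qed
  from Q.prime_power_order_center[OF p k this] obtain Z where Z: "Z \<in> carrier (G Mod N)" "Z \<noteq> N"
    "\<And>X. X \<in> carrier (G Mod N) \<Longrightarrow> X <#> Z = Z <#> X" by auto
  then obtain z where z: "z \<in> carrier G" "Z = N #> z" by (auto simp: carrier_FactGroup)
  have "z \<notin> N" using Z(2) z N.rcos_const by blast
  moreover have "commutator G g z \<in> N" if g: "g \<in> carrier G" for g
  proof -
    have "N #> (g \<otimes> z) = N #> (z \<otimes> g)"
      using Z(3)[of "N #> g"] g z by (simp add: carrier_FactGroup N.rcos_sum)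
    then have "g \<otimes> z \<otimes> inv (z \<otimes> g) \<in> N"
      using g z(1) N.rcos_module_imp[of "z \<otimes> g" "g \<otimes> z"] rcos_self[OF _ N.subgroup_axioms, of "g \<otimes> z"]
      by (simp add: is_group)
    then show ?thesis using g z(1) by (simp add: commutator_def inv_mult_group m_assoc)
  qed
  ultimately show ?thesis using z(1) by blast
qed

lemma commutator_in_normal:
  assumes "N \<lhd> G" "g \<in> carrier G" "y \<in> N" shows "commutator G g y \<in> N"
proof -
  interpret normal N G by fact
  show ?thesis using assms(2,3) by (simp add: commutator_eq(2) conj_by_def inv_op_closed2)
qed

text \<open>The set is the preimage of the center of \<open>G Mod N\<close>. Being a subgroup, it
  contains everything generated by \<open>N\<close> and an element central modulo
  \<open>N\<close>.\<close>

lemma central_modulo_subgroup: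
  assumes N: "N \<lhd> G"
  shows "subgroup {x \<in> carrier G. \<forall>g\<in>carrier G. commutator G g x \<in> N} G" (is "subgroup ?C G")
proof -
  interpret N: normal N G by fact
  show ?thesis
  proof (rule subgroupI)
    have "\<one> \<in> ?C" using commutator_in_normal[OF N] N.one_closed by simp
    then show "?C \<noteq> {}" by blast
    fix x assume x: "x \<in> ?C"
    have "commutator G g (inv x) \<in> N" if g: "g \<in> carrier G" for g
    proof -
      have "commutator G (conj_by G (inv x) g) x \<in> N" using x g by simp
      then have "inv (commutator G (conj_by G (inv x) g) x) \<in> N" by simp
      then show ?thesis using x g
        by (simp add: commutator_def conj_by_def inv_mult_group m_assoc inv_mult_cancel)
    qed
    then show "inv x \<in> ?C" using x by simp
    fix y assume y: "y \<in> ?C"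
    have "commutator G g (x \<otimes> y) \<in> N" if g: "g \<in> carrier G" for g
    proof -
      have "commutator G g (x \<otimes> y) = commutator G g x \<otimes> (x \<otimes> commutator G g y \<otimes> inv x)"
        using x y g by (simp add: commutator_def inv_mult_group m_assoc inv_mult_cancel)
      then show ?thesis using x y g by (simp add: N.inv_op_closed2)
    qed
    then show "x \<otimes> y \<in> ?C" using x y by simp
  qed auto
qed

text \<open>All elements of the generated subgroup are central modulo \<open>N\<close>, so
  conjugation multiplies them by elements of \<open>N\<close>.\<close>

lemma generate_insert_normal:
  assumes N: "N \<lhd> G" and z: "z \<in> carrier G"
    and central: "\<And>g. g \<in> carrier G \<Longrightarrow> commutator G g z \<in> N"
  shows "generate G (insert z N) \<lhd> G"
proof (rule normal_invI)
  interpret N: normal N G by fact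
  have sub: "insert z N \<subseteq> carrier G" using z N.subset by simp
  then show "subgroup (generate G (insert z N)) G" by (rule generate_is_subgroup)
  have "insert z N \<subseteq> {x \<in> carrier G. \<forall>g\<in>carrier G. commutator G g x \<in> N}"
    using z central commutator_in_normal[OF N] by auto
  note incl = generate_subgroup_incl[OF this central_modulo_subgroup[OF N]]
  fix g x assume g: "g \<in> carrier G" and x: "x \<in> generate G (insert z N)"
  then have xc: "x \<in> carrier G" and "commutator G g x \<in> N" using incl by auto
  then have "commutator G g x \<in> generate G (insert z N)" by (auto intro: generate.incl)
  moreover have "g \<otimes> x \<otimes> inv g = commutator G g x \<otimes> x"
    using g xc by (simp add: commutator_def m_assoc)
  ultimately show "g \<otimes> x \<otimes> inv g \<in> generate G (insert z N)"
    using x generate.eng by metis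
qed

text \<open>\<open>f\<close> is constant on right cosets of \<open>H\<close>, so it has at most as
  many values as there are cosets; Lagrange's theorem does the rest.\<close>

lemma card_image_le_rcosets:
  assumes H: "subgroup H G" and fin: "finite (carrier G)"
    and f: "\<And>h x. h \<in> H \<Longrightarrow> x \<in> carrier G \<Longrightarrow> f (h \<otimes> x) = f x"
  shows "card (f ` carrier G) * card H \<le> order G"
proof -
  interpret H: subgroup H G by fact
  have eq: "f x = the_elem (f ` (H #> x))" if "x \<in> carrier G" for x
  proof -
    have "f ` (H #> x) = {f x}"
      using f that rcos_self[OF that H] by (auto simp: r_coset_def image_iff)
    then show ?thesis by simp
  qed
  have "f ` carrier G \<subseteq> (\<lambda>C. the_elem (f ` C)) ` (rcosets H)"
    using eq by (auto simp: RCOSETS_def)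
  moreover have "finite (rcosets H)"
    using fin by (metis rcosets_part_G[OF H] finite_UnionD)
  ultimately have "card (f ` carrier G) \<le> card (rcosets H)"
    by (meson surj_card_le)
  then show ?thesis by (metis H lagrange mult_le_mono1)
qed

end

section \<open>Pairing with an element central modulo a normal subgroup of the radical\<close>

context alternating_pairing
begin

context
  fixes N z
  assumes N: "N \<lhd> G" and radical: "\<And>y g. y \<in> N \<Longrightarrow> g \<in> carrier G \<Longrightarrow> w y g = \<one>\<^bsub>L\<^esub>"
    and z: "z \<in> carrier G" and central: "\<And>g. g \<in> carrier G \<Longrightarrow> commutator G g z \<in> N"
begin

interpretation N: normal N G by (rule N)

text \<open>The commutator of \<open>x\<close> and \<open>g\<close> lies in \<open>N\<close> and so
  pairs trivially with \<open>h\<close>; by \<open>w_commutator_left\<close> this says that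
  \<open>h\<close> fixes \<open>w x g\<close>.\<close>

private lemma w_conj_central:
  assumes x: "x \<in> carrier G" "\<And>g. g \<in> carrier G \<Longrightarrow> commutator G g x \<in> N"
    and g: "g \<in> carrier G" and h: "h \<in> carrier G"
  shows "w (conj_by G h x) (conj_by G h g) = w x g"
proof -
  have "commutator G x g \<in> N"
    using x g N G.commutator_in_normal_swap by blast
  then have "w x g \<otimes>\<^bsub>L\<^esub> inv\<^bsub>L\<^esub> w (conj_by G h x) (conj_by G h g) = \<one>\<^bsub>L\<^esub>"
    using x g h by (simp flip: w_commutator_left add: radical)
  then show ?thesis using x(1) g h by (simp add: L.inv_solve_right' )
qed

text \<open>Invariance under conjugation removes the twist from \<open>w_mult_right\<close>.\<close>

lemma w_central_hom: "w z \<in> hom G L"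
  by (rule homI) (use z in \<open>simp_all add: w_mult_right w_conj_central[OF z central]\<close>)

text \<open>By the same invariance \<open>x \<mapsto> w x g\<close> reverses products on elements
  central modulo \<open>N\<close>, and the image of the homomorphism \<open>w z\<close> is a
  subgroup. Membership in that image can therefore be checked on generators.\<close>

private lemma central_subgroup:
  "subgroup {x \<in> carrier G. (\<forall>g\<in>carrier G. commutator G g x \<in> N) \<and>
     (\<forall>g\<in>carrier G. w x g \<in> w z ` carrier G)} G" (is "subgroup ?S G")
proof -
  interpret h: group_hom G L "w z"
    by (intro group_hom.intro group_hom_axioms.intro w_central_hom G.group_axioms L.group_axioms)
  interpret I: subgroup "w z ` carrier G" L by (rule h.img_is_subgroup)
  note C = G.central_modulo_subgroup[OF N]
  show ?thesis
  proof (rule G.subgroupI)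
    show "?S \<noteq> {}" using z central by blast
    fix x assume "x \<in> ?S"
    then have x: "x \<in> carrier G" "\<And>g. g \<in> carrier G \<Longrightarrow> commutator G g x \<in> N"
      "\<And>g. g \<in> carrier G \<Longrightarrow> w x g \<in> w z ` carrier G" by auto
    have cx: "commutator G g (inv\<^bsub>G\<^esub> x) \<in> N" if g: "g \<in> carrier G" for g
      using subgroup.m_inv_closed[OF C, of x] x g by blast
    have wx: "w (inv\<^bsub>G\<^esub> x) g = inv\<^bsub>L\<^esub> w x g" if g: "g \<in> carrier G" for g
    proof -
      have "\<one>\<^bsub>L\<^esub> = w (x \<otimes>\<^bsub>G\<^esub> inv\<^bsub>G\<^esub> x) g" using x g by simp
      also have "\<dots> = w (inv\<^bsub>G\<^esub> x) g \<otimes>\<^bsub>L\<^esub> w x g"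
        using x g cx by (subst w_mult_left) (simp_all add: w_conj_central)
      finally show ?thesis using x g by (metis G.inv_closed L.inv_equality w_closed)
    qed
    show "inv\<^bsub>G\<^esub> x \<in> ?S" using x cx wx by simp
    fix y assume "y \<in> ?S"
    then have y: "y \<in> carrier G" "\<And>g. g \<in> carrier G \<Longrightarrow> commutator G g y \<in> N"
      "\<And>g. g \<in> carrier G \<Longrightarrow> w y g \<in> w z ` carrier G" by auto
    have cxy: "commutator G g (x \<otimes>\<^bsub>G\<^esub> y) \<in> N" if g: "g \<in> carrier G" for g
      using subgroup.m_closed[OF C, of x y] x y g by blast
    have "w (x \<otimes>\<^bsub>G\<^esub> y) g = w y g \<otimes>\<^bsub>L\<^esub> w x g" if g: "g \<in> carrier G" for g
      using x y g by (simp add: w_mult_left w_conj_central)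
    then show "x \<otimes>\<^bsub>G\<^esub> y \<in> ?S" using x y cxy by simp
  qed auto
qed

lemma w_in_image:
  assumes "x \<in> generate G (insert z N)" "g \<in> carrier G"
  shows "w x g \<in> w z ` carrier G"
proof -
  have "\<one>\<^bsub>L\<^esub> \<in> w z ` carrier G" using z by (metis G.one_closed image_eqI w_one_right)
  then have "insert z N \<subseteq> {x \<in> carrier G. (\<forall>g\<in>carrier G. commutator G g x \<in> N) \<and>
     (\<forall>g\<in>carrier G. w x g \<in> w z ` carrier G)}"
    using z central G.commutator_in_normal[OF N] by (auto simp: radical)
  from G.generate_subgroup_incl[OF this central_subgroup] show ?thesis using assms by blast
qed

text \<open>\<open>w z\<close> kills \<open>z\<close> because the pairing is alternating, and
  \<open>N\<close> because \<open>N\<close> lies in the radical; hence it is constant on the cosets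
  of the subgroup they generate.\<close>

lemma card_w_central_image:
  assumes "finite (carrier G)"
  shows "card (w z ` carrier G) * card (generate G (insert z N)) \<le> order G"
proof (rule G.card_image_le_rcosets)
  interpret h: group_hom G L "w z"
    by (intro group_hom.intro group_hom_axioms.intro w_central_hom G.group_axioms L.group_axioms)
  show "subgroup (generate G (insert z N)) G"
    using z N.subset by (intro G.generate_is_subgroup) auto
  have "insert z N \<subseteq> kernel G L (w z)"
    using z radical by (auto simp: kernel_def w_swap[of _ z])
  then have "generate G (insert z N) \<subseteq> kernel G L (w z)"
    by (rule G.generate_subgroup_incl[OF _ h.subgroup_kernel])
  then show "w z (y \<otimes>\<^bsub>G\<^esub> x) = w z x" if "y \<in> generate G (insert z N)" "x \<in> carrier G" for y x
    using that by (auto simp: kernel_def)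
qed fact

end

end

section \<open>Images of exterior products and their orders\<close>

context alternating_pairing
begin

text \<open>For normal \<open>N\<close> this is the image in \<open>L\<close> of the exterior
  product of \<open>N\<close> and \<open>G\<close>.\<close>

definition pairing_subgroup :: "'a set \<Rightarrow> 'c set" where
  "pairing_subgroup N = generate L {w y g | y g. y \<in> N \<and> g \<in> carrier G}"

lemma pairing_subgroup_generators:
  assumes "N \<subseteq> carrier G" shows "{w y g | y g. y \<in> N \<and> g \<in> carrier G} \<subseteq> carrier L"
  using assms by auto

lemma subgroup_pairing_subgroup: "N \<subseteq> carrier G \<Longrightarrow> subgroup (pairing_subgroup N) L"
  unfolding pairing_subgroup_def by (rule L.generate_is_subgroup[OF pairing_subgroup_generators])

lemma w_in_pairing_subgroup: "y \<in> N \<Longrightarrow> g \<in> carrier G \<Longrightarrow> w y g \<in> pairing_subgroup N"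
  unfolding pairing_subgroup_def by (rule generate.incl) blast

text \<open>\<open>c\<close> is a product of commutators, one for each generator occurring in
  \<open>t\<close>. Its existence stands in for a homomorphism from \<open>L\<close> to
  \<open>G\<close>, which this locale does not provide.\<close>

lemma pairing_subgroup_conj:
  assumes "t \<in> pairing_subgroup (carrier G)"
  shows "\<exists>c\<in>carrier G. \<forall>a\<in>carrier G. \<forall>b\<in>carrier G. conj_by L t (w a b) = w (conj_by G c a) (conj_by G c b)"
  using assms unfolding pairing_subgroup_def
proof induction
  case one
  show ?case by (intro bexI[of _ "\<one>\<^bsub>G\<^esub>"]) auto
next
  case (incl h)
  then obtain a b where ab: "a \<in> carrier G" "b \<in> carrier G" "h = w a b" by blast
  then show ?case
    by (intro bexI[of _ "commutator G a b"]) (simp_all add: w_conj G.commutator_closed)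
next
  case (inv h)
  then obtain a b where ab: "a \<in> carrier G" "b \<in> carrier G" "inv\<^bsub>L\<^esub> h = w b a" using inv_w by blast
  then show ?case
    by (intro bexI[of _ "commutator G b a"]) (simp_all add: w_conj G.commutator_closed)
next
  case (eng s t)
  obtain c where c: "c \<in> carrier G"
    "\<And>a b. a \<in> carrier G \<Longrightarrow> b \<in> carrier G \<Longrightarrow> conj_by L s (w a b) = w (conj_by G c a) (conj_by G c b)"
    using eng.IH(1) by blast
  obtain d where d: "d \<in> carrier G"
    "\<And>a b. a \<in> carrier G \<Longrightarrow> b \<in> carrier G \<Longrightarrow> conj_by L t (w a b) = w (conj_by G d a) (conj_by G d b)"
    using eng.IH(2) by blast
  have "s \<in> carrier L" "t \<in> carrier L"
    using eng(1,2) L.generate_in_carrier[OF pairing_subgroup_generators] by auto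
  then show ?case
    using c d by (intro bexI[of _ "c \<otimes>\<^bsub>G\<^esub> d"]) (simp_all add: L.conj_by_mult_left G.conj_by_mult_left)
qed

text \<open>By \<open>pairing_subgroup_conj\<close> and the normality of \<open>N\<close>,
  conjugation maps generators to generators. Only elements generated by pairing values are known to
  act this way, whence the restricted ambient group.\<close>

lemma pairing_subgroup_normal:
  assumes N: "N \<lhd> G"
  shows "pairing_subgroup N \<lhd> L\<lparr>carrier := pairing_subgroup (carrier G)\<rparr>"
proof -
  interpret N: normal N G by fact
  let ?K = "pairing_subgroup (carrier G)"
  interpret K: subgroup ?K L by (rule subgroup_pairing_subgroup) simp
  interpret LK: group "L\<lparr>carrier := ?K\<rparr>" by (rule K.subgroup_is_group) (rule L.group_axioms)
  let ?S = "{w y g | y g. y \<in> N \<and> g \<in> carrier G}"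
  have S: "?S \<subseteq> ?K" using w_in_pairing_subgroup N.subset by blast
  have "generate (L\<lparr>carrier := ?K\<rparr>) ?S \<lhd> L\<lparr>carrier := ?K\<rparr>"
  proof (rule LK.normal_generateI)
    fix h t assume h: "h \<in> ?S" and t: "t \<in> carrier (L\<lparr>carrier := ?K\<rparr>)"
    then have "t \<in> ?K" by simp
    from pairing_subgroup_conj[OF this] obtain c where c: "c \<in> carrier G"
      "\<forall>a\<in>carrier G. \<forall>b\<in>carrier G. conj_by L t (w a b) = w (conj_by G c a) (conj_by G c b)" ..
    obtain y g where yg: "y \<in> N" "g \<in> carrier G" "h = w y g" using h by auto
    have "conj_by G c y \<in> N" using yg c by (simp add: conj_by_def N.inv_op_closed2)
    moreover have "conj_by L t h = w (conj_by G c y) (conj_by G c g)" using yg c by simp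
    ultimately have "conj_by L t h \<in> ?S" using yg c(1) G.conj_by_closed by blast
    then show "t \<otimes>\<^bsub>L\<lparr>carrier := ?K\<rparr>\<^esub> h \<otimes>\<^bsub>L\<lparr>carrier := ?K\<rparr>\<^esub> inv\<^bsub>L\<lparr>carrier := ?K\<rparr>\<^esub> t \<in> ?S"
      using t by (simp add: conj_by_def L.m_inv_consistent[OF K.subgroup_axioms])
  qed (use S in simp)
  then show ?thesis
    using L.generate_consistent[OF S K.subgroup_axioms] by (simp add: pairing_subgroup_def)
qed

text \<open>Modulo the image for \<open>N\<close>, the subgroup \<open>N\<close> pairs trivially, so
  the image for \<open>M\<close> lies in that of the single homomorphism \<open>?w z\<close>, whose
  order is at most that of \<open>G\<close> divided by that of \<open>M\<close>.\<close>

lemma card_pairing_subgroup_step: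
  assumes fin: "finite (carrier G)" and N: "N \<lhd> G" and finN: "finite (pairing_subgroup N)"
    and z: "z \<in> carrier G" and central: "\<And>g. g \<in> carrier G \<Longrightarrow> commutator G g z \<in> N"
  defines "M \<equiv> generate G (insert z N)"
  shows "finite (pairing_subgroup M)"
    and "card (pairing_subgroup M) * card M \<le> card (pairing_subgroup N) * order G"
proof -
  interpret N: normal N G by fact
  let ?K = "pairing_subgroup (carrier G)" and ?T = "pairing_subgroup N"
  let ?LK = "L\<lparr>carrier := ?K\<rparr>"
  interpret K: subgroup ?K L by (rule subgroup_pairing_subgroup) simp
  interpret T: subgroup ?T L by (rule subgroup_pairing_subgroup) (rule N.subset)
  interpret T': normal ?T ?LK using N by (rule pairing_subgroup_normal)
  interpret c: crossed_pairing G ?LK w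
    by (rule crossed_pairing_image[OF K.subgroup_axioms]) (rule w_in_pairing_subgroup)
  let ?w = "\<lambda>g h. ?T #>\<^bsub>?LK\<^esub> w g h"
  interpret q: crossed_pairing G "?LK Mod ?T" ?w
    by (rule c.crossed_pairing_quotient) (rule T'.normal_axioms)
  have join: "?T #>\<^bsub>L\<^esub> t = ?T" if "t \<in> ?T" for t using that by (rule T.rcos_const[OF L.group_axioms])
  interpret q: alternating_pairing G "?LK Mod ?T" ?w
    by unfold_locales (simp add: join)
  have radical: "?w y g = \<one>\<^bsub>?LK Mod ?T\<^esub>" if "y \<in> N" "g \<in> carrier G" for y g
    using that by (simp add: join w_in_pairing_subgroup)
  note im = q.w_in_image[OF N radical z central, folded M_def]
  let ?I = "?w z ` carrier G"
  interpret h: group_hom G "?LK Mod ?T" "?w z"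
    by (intro group_hom.intro group_hom_axioms.intro q.w_central_hom[OF N radical z central]
        G.group_axioms q.L.group_axioms)
  interpret I: subgroup ?I "?LK Mod ?T" by (rule h.img_is_subgroup)
  have Mc: "M \<subseteq> carrier G"
    unfolding M_def using z N.subset by (intro G.generate_incl) auto
  \<comment> \<open>The cosets of the pairing values on \<open>M\<close> lie in \<open>?I\<close> by
    \<open>im\<close>; as \<open>?I\<close> is a subgroup, so do those of their products and
    inverses.\<close>
  have gen: "t \<in> ?K \<and> ?T #>\<^bsub>L\<^esub> t \<in> ?I" if "t \<in> pairing_subgroup M" for t
    using that unfolding pairing_subgroup_def[of M]
  proof induction
    case one
    then show ?case using I.one_closed join by simp
  next
    case (incl h)
    then obtain x g where "x \<in> M" "g \<in> carrier G" "h = w x g" by blast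
    then show ?case using im[of x g] Mc w_in_pairing_subgroup[of x "carrier G" g] by auto
  next
    case (inv h)
    then obtain x g where "x \<in> M" "g \<in> carrier G" "h = w x g" by blast
    then have h: "h \<in> ?K" "?T #>\<^bsub>L\<^esub> h \<in> ?I"
      using im[of x g] Mc w_in_pairing_subgroup[of x "carrier G" g] by auto
    have "?T #>\<^bsub>L\<^esub> inv\<^bsub>L\<^esub> h = inv\<^bsub>?LK Mod ?T\<^esub> (?T #>\<^bsub>L\<^esub> h)"
      using T'.inv_FactGroup[of "?T #>\<^bsub>L\<^esub> h"] T'.rcos_inv[of h] h(1)
      by (simp add: carrier_FactGroup L.m_inv_consistent[OF K.subgroup_axioms])
    then show ?case using h I.m_inv_closed by simp
  next
    case (eng s t)
    then have "?T #>\<^bsub>L\<^esub> (s \<otimes>\<^bsub>L\<^esub> t) = (?T #>\<^bsub>L\<^esub> s) \<otimes>\<^bsub>?LK Mod ?T\<^esub> (?T #>\<^bsub>L\<^esub> t)"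
      using T'.rcos_sum[of s t] by simp
    then show ?case using eng I.m_closed by simp
  qed
  \<comment> \<open>Counting: the image for \<open>M\<close> is covered by the cosets in
    \<open>?I\<close>, each of the size of \<open>?T\<close>.\<close>
  have sub: "pairing_subgroup M \<subseteq> \<Union>?I"
  proof
    fix t assume "t \<in> pairing_subgroup M"
    then have t: "t \<in> ?K" "?T #>\<^bsub>L\<^esub> t \<in> ?I" using gen by auto
    show "t \<in> \<Union>?I"
      using UnionI[OF t(2)] L.rcos_self[OF K.mem_carrier[OF t(1)] T.subgroup_axioms] .
  qed
  have cos: "finite C \<and> card C = card ?T" if C: "C \<in> ?I" for C
  proof -
    obtain g where "g \<in> carrier G" "C = ?T #>\<^bsub>L\<^esub> w z g" using C by auto
    then have "C \<in> rcosets\<^bsub>L\<^esub> ?T" using z L.rcosetsI[OF T.subset] by simp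
    then show ?thesis
      using L.card_rcosets_equal[OF _ T.subset, of C] L.rcosets_finite[OF _ T.subset finN, of C] by simp
  qed
  have finI: "finite ?I" using fin by simp
  have finU: "finite (\<Union>?I)"
    using finI conjunct1[OF cos] by (rule finite_Union)
  with sub show "finite (pairing_subgroup M)" by (rule finite_subset)
  have "card (pairing_subgroup M) \<le> card (\<Union>?I)" using finU sub by (rule card_mono)
  also have "\<dots> \<le> (\<Sum>C\<in>?I. card C)" by (rule card_Union_le_sum_card)
  also have "\<dots> = card ?I * card ?T"
    by (simp only: sum_constant of_nat_id conjunct2[OF cos] cong: sum.cong)
  finally have "card (pairing_subgroup M) * card M \<le> card ?I * card ?T * card M" by simp
  also have "\<dots> = card ?T * (card ?I * card M)" by simp
  also have "\<dots> \<le> card ?T * order G"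
    unfolding M_def using q.card_w_central_image[OF N radical z central fin] by (rule mult_le_mono2)
  finally show "card (pairing_subgroup M) * card M \<le> card ?T * order G" .
qed

text \<open>Induction along an ascending central series: passing from \<open>N\<close> to a larger
  normal subgroup of order \<open>p ^ j\<close> costs a factor \<open>p ^ (n - j)\<close>. The
  exponents add up to a triangular number when \<open>j\<close> grows by 1 each time, and to less
  otherwise.\<close>

lemma card_pairing_subgroup_prime_power_aux:
  assumes p: "Factorial_Ring.prime (p::nat)" and ord: "order G = p ^ n"
    and "N \<lhd> G" and "finite (pairing_subgroup N)" and "card N = p ^ i" and "i \<le> n"
  shows "finite (pairing_subgroup (carrier G)) \<and>
    card (pairing_subgroup (carrier G)) \<le> card (pairing_subgroup N) * p ^ ((n - i) * (n - i - 1) div 2)"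
  using assms(3-)
proof (induction "n - i" arbitrary: N i rule: less_induct)
  case (less i N)
  interpret N: normal N G by fact
  have fin: "finite (carrier G)"
    using ord prime_gt_0_nat[OF p] by (simp flip: G.order_gt_0_iff_finite)
  have p1: "1 < p" using p by (rule prime_gt_1_nat)
  show ?case
  proof (cases "N = carrier G")
    case True
    then have "i = n" using less.prems ord p1 by (simp add: order_def)
    with True less.prems show ?thesis by simp
  next
    case False
    then obtain z where z: "z \<in> carrier G" "z \<notin> N" "\<And>g. g \<in> carrier G \<Longrightarrow> commutator G g z \<in> N"
      using G.prime_power_order_central_modulo[OF p ord less.prems(1)] by blast
    define M where "M = generate G (insert z N)"
    have M: "M \<lhd> G"
      unfolding M_def using less.prems(1) z(1,3) by (rule G.generate_insert_normal)
    then interpret M: normal M G .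
    have NM: "N \<subset> M" using z(2) unfolding M_def by (auto intro: generate.incl)
    have "card M dvd p ^ n"
      using G.lagrange[OF M.subgroup_axioms] ord by (metis dvd_triv_right)
    then obtain j where j: "card M = p ^ j" "j \<le> n" using p by (auto simp: divides_primepow_nat)
    have "card N < card M" using NM fin M.subset by (meson finite_subset psubset_card_mono)
    then have ij: "i < j" using less.prems(3) j(1) p1 by simp
    note step = card_pairing_subgroup_step[OF fin less.prems(1,2) z(1,3), folded M_def]
    have "n - j < n - i" using ij j(2) by simp
    from less.hyps[OF this M step(1) j]
    have IH: "finite (pairing_subgroup (carrier G))" "card (pairing_subgroup (carrier G))
        \<le> card (pairing_subgroup M) * p ^ ((n - j) * (n - j - 1) div 2)" by auto
    have "card (pairing_subgroup M) * p ^ j \<le> (card (pairing_subgroup N) * p ^ (n - j)) * p ^ j"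
    proof -
      have "p ^ n = p ^ (n - j) * p ^ j" using j(2) by (simp flip: power_add)
      then show ?thesis using step(2) unfolding j(1) ord by (simp only: mult.assoc)
    qed
    then have 1: "card (pairing_subgroup M) \<le> card (pairing_subgroup N) * p ^ (n - j)"
      using p1 by simp
    \<comment> \<open>With \<open>b = n - j\<close>, which is at most \<open>n - i - 1\<close>, the
      left side is \<open>b * (b + 1) div 2\<close>.\<close>
    have 2: "n - j + (n - j) * (n - j - 1) div 2 \<le> (n - i) * (n - i - 1) div 2"
    proof -
      obtain b where b: "n - j = b" by simp
      have "b + 1 \<le> n - i" using ij j(2) b by simp
      then have "(b + 1) * b \<le> (n - i) * (n - i - 1)" by (intro mult_le_mono) simp_all
      then have "(2 * b + b * (b - 1)) div 2 \<le> (n - i) * (n - i - 1) div 2"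
        by (intro div_le_mono) (cases b; simp add: algebra_simps)
      then show ?thesis by (simp add: b)
    qed
    have "card (pairing_subgroup (carrier G))
        \<le> card (pairing_subgroup N) * p ^ (n - j) * p ^ ((n - j) * (n - j - 1) div 2)"
      using IH(2) 1 by (meson dual_order.trans mult_le_mono1)
    also have "\<dots> = card (pairing_subgroup N) * p ^ (n - j + (n - j) * (n - j - 1) div 2)"
      by (simp add: power_add)
    also have "\<dots> \<le> card (pairing_subgroup N) * p ^ ((n - i) * (n - i - 1) div 2)"
      using 2 p1 by (intro mult_le_mono2 power_increasing) auto
    finally show ?thesis using IH(1) by simp
  qed
qed

theorem card_pairing_subgroup_prime_power:
  assumes p: "Factorial_Ring.prime (p::nat)" and ord: "order G = p ^ n"
  shows "finite (pairing_subgroup (carrier G))"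
    and "card (pairing_subgroup (carrier G)) \<le> p ^ (n * (n - 1) div 2)"
proof -
  have "{w y g | y g. y \<in> {\<one>\<^bsub>G\<^esub>} \<and> g \<in> carrier G} = {\<one>\<^bsub>L\<^esub>}"
    by (auto intro!: exI[of _ "\<one>\<^bsub>G\<^esub>"])
  then have "pairing_subgroup {\<one>\<^bsub>G\<^esub>} = {\<one>\<^bsub>L\<^esub>}"
    by (simp add: pairing_subgroup_def L.generate_one)
  then show "finite (pairing_subgroup (carrier G))"
    "card (pairing_subgroup (carrier G)) \<le> p ^ (n * (n - 1) div 2)"
    using card_pairing_subgroup_prime_power_aux[OF p ord G.one_is_normal, of 0] by simp_all
qed

end

section \<open>Transfer\<close>

text \<open>The transfer \<open>V\<close> from \<open>G\<close> to the abelianization of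
  \<open>Q\<close> kills commutators, while on a central element of \<open>Q\<close> it is the power
  with exponent the index. The index enters as the size of a finite transversal because
  \<open>G\<close> itself may be infinite.\<close>

lemma (in group) transfer_central_power:
  assumes Q: "subgroup Q G" and S: "S \<subseteq> carrier G" "finite S"
    and transversal: "\<And>x. x \<in> carrier G \<Longrightarrow> \<exists>!s. s \<in> S \<and> x \<otimes> inv s \<in> Q"
    and a: "a \<in> derived G (carrier G)" "a \<in> Q" and central: "\<And>x. x \<in> carrier G \<Longrightarrow> a \<otimes> x = x \<otimes> a"
  shows "a [^] card S \<in> derived G Q"
proof -
  interpret Q: subgroup Q G by fact
  let ?D = "derived G Q"
  let ?A = "G\<lparr>carrier := Q\<rparr> Mod ?D"
  interpret D: normal ?D "G\<lparr>carrier := Q\<rparr>" using Q by (rule derived_subgroup_is_normal)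
  interpret A: comm_group ?A using Q by (rule derived_quot_of_subgroup_is_comm_group)
  have D: "subgroup ?D G" by (rule derived_is_subgroup) (rule Q.subset)
  have coset: "?D #> q \<in> carrier ?A" if "q \<in> Q" for q
    using that by (auto simp: carrier_FactGroup)
  have coset_mult: "?D #> (q \<otimes> q') = (?D #> q) \<otimes>\<^bsub>?A\<^esub> (?D #> q')" if "q \<in> Q" "q' \<in> Q" for q q'
    using that D.rcos_sum[of q q'] by simp
  \<comment> \<open>\<open>t x\<close> represents the right coset of \<open>x\<close>, and
    \<open>c s x\<close> below is the element of \<open>Q\<close> by which
    \<open>s \<otimes> x\<close> differs from its representative.\<close>
  define t where "t x = (THE s. s \<in> S \<and> x \<otimes> inv s \<in> Q)" for x
  have t: "t x \<in> S" "x \<otimes> inv (t x) \<in> Q" if "x \<in> carrier G" for x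
    using theI'[OF transversal[OF that]] by (simp_all add: t_def)
  have t_eq: "t x = s" if "x \<in> carrier G" "s \<in> S" "x \<otimes> inv s \<in> Q" for x s
    using transversal[OF that(1)] t[OF that(1)] that(2,3) by blast
  have tc: "t x \<in> carrier G" if "x \<in> carrier G" for x using t(1)[OF that] S by blast
  define c where "c s x = s \<otimes> x \<otimes> inv (t (s \<otimes> x))" for s x
  have c: "c s x \<in> Q" if "s \<in> S" "x \<in> carrier G" for s x
    using that S by (auto simp: c_def intro: t)
  define V where "V x = finprod ?A (\<lambda>s. ?D #> c s x) S" for x
  have Vc: "V x \<in> carrier ?A" if "x \<in> carrier G" for x
    unfolding V_def using that c coset by (intro A.finprod_closed) auto
  have V_mult: "V (x \<otimes> y) = V x \<otimes>\<^bsub>?A\<^esub> V y" if x: "x \<in> carrier G" and y: "y \<in> carrier G" for x y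
  proof -
    let ?h = "\<lambda>s. t (s \<otimes> x)"
    \<comment> \<open>Right multiplication by \<open>x\<close> permutes the cosets and hence their
      representatives, which allows reindexing the product in \<open>V\<close>.\<close>
    have inj: "inj_on ?h S"
    proof (rule inj_onI)
      fix s s' assume s: "s \<in> S" "s' \<in> S" and eq: "?h s = ?h s'"
      have sc: "s \<in> carrier G" "s' \<in> carrier G" using s S by auto
      have "c s x \<otimes> inv (c s' x) \<in> Q" using c s x by simp
      moreover have "c s x \<otimes> inv (c s' x) = s \<otimes> inv s'"
        using sc x tc[of "s' \<otimes> x"] eq by (simp add: c_def inv_mult_group m_assoc inv_mult_cancel)
      ultimately have "t s = s'" using sc s by (intro t_eq) simp_all
      moreover have "t s = s" using sc s by (intro t_eq) simp_all
      ultimately show "s = s'" by simp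
    qed
    have im: "?h ` S = S"
      using inj S x by (intro card_subset_eq) (auto simp: card_image intro!: t)
    have hS: "?h s \<in> S" if "s \<in> S" for s using that im by blast
    \<comment> \<open>The cocycle identity: the product on the right telescopes, and uniqueness of
      representatives identifies what remains.\<close>
    have cc: "c s (x \<otimes> y) = c s x \<otimes> c (?h s) y" if s: "s \<in> S" for s
    proof -
      have sc: "s \<in> carrier G" using s S by auto
      let ?u = "t (s \<otimes> x)"
      let ?v = "t (?u \<otimes> y)"
      have u: "?u \<in> S" "?u \<in> carrier G" using sc x t tc by auto
      have v: "?v \<in> S" "?v \<in> carrier G" using u y t tc by auto
      have e: "c s x \<otimes> c ?u y = s \<otimes> (x \<otimes> y) \<otimes> inv ?v"
        using sc x y u v by (simp add: c_def m_assoc inv_mult_cancel)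
      have "c s x \<otimes> c ?u y \<in> Q" using s u c x y by simp
      then have "t (s \<otimes> (x \<otimes> y)) = ?v" using sc x y v by (intro t_eq) (simp_all add: e)
      then show ?thesis by (simp only: e) (simp add: c_def)
    qed
    have "V (x \<otimes> y) = finprod ?A (\<lambda>s. (?D #> c s x) \<otimes>\<^bsub>?A\<^esub> (?D #> c (?h s) y)) S"
      unfolding V_def
    proof (rule A.finprod_cong')
      show "(\<lambda>s. (?D #> c s x) \<otimes>\<^bsub>?A\<^esub> (?D #> c (?h s) y)) \<in> S \<rightarrow> carrier ?A"
        using c[OF _ x] c[OF hS y] by (intro Pi_I A.m_closed coset)
      show "?D #> c s (x \<otimes> y) = (?D #> c s x) \<otimes>\<^bsub>?A\<^esub> (?D #> c (?h s) y)" if "s \<in> S" for s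
        using that by (simp only: cc) (intro coset_mult c hS x y)
    qed simp
    also have "\<dots> = V x \<otimes>\<^bsub>?A\<^esub> finprod ?A (\<lambda>s. ?D #> c (?h s) y) S"
      unfolding V_def by (intro A.finprod_multf Pi_I coset c hS x y)
    also have "finprod ?A (\<lambda>s. ?D #> c (?h s) y) S = finprod ?A (\<lambda>s. ?D #> c s y) (?h ` S)"
      using inj by (intro A.finprod_reindex[symmetric] Pi_I) (auto intro: coset c hS y)
    also have "\<dots> = V y" by (simp add: im V_def)
    finally show ?thesis .
  qed
  interpret V: group_hom G ?A V
    by (intro group_hom.intro group_hom_axioms.intro is_group A.is_group homI Vc V_mult)
  have "V ` carrier G \<subseteq> carrier ?A" using Vc by blast
  then have "V ` derived G (carrier G) = {\<one>\<^bsub>?A\<^esub>}"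
    using V.derived_img[of "carrier G"] A.derived_eq_singleton[of "V ` carrier G"] by simp
  then have "V a = \<one>\<^bsub>?A\<^esub>" using a(1) by blast
  moreover have "V a = (?D #> a) [^]\<^bsub>?A\<^esub> card S"
  proof -
    \<comment> \<open>Being central and in \<open>Q\<close>, \<open>a\<close> fixes every coset, so
      all factors of \<open>V a\<close> are the coset of \<open>a\<close>.\<close>
    have "c s a = a" if s: "s \<in> S" for s
    proof -
      have sc: "s \<in> carrier G" using s S by auto
      have e: "s \<otimes> a \<otimes> inv s = a" using sc a(2) by (simp add: central[OF sc, symmetric] m_assoc)
      then have "t (s \<otimes> a) = s" using s sc a(2) by (intro t_eq) simp_all
      then show ?thesis by (simp add: c_def e)
    qed
    then have "V a = finprod ?A (\<lambda>_. ?D #> a) S"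
      unfolding V_def using a(2) by (intro A.finprod_cong') (auto intro: coset)
    then show ?thesis using a(2) by (simp add: A.finprod_const coset)
  qed
  moreover have "(?D #> a) [^]\<^bsub>?A\<^esub> card S = ?D #> (a [^] card S)"
    using D.FactGroup_pow[of a "card S"] a(2) by (simp add: nat_pow_consistent[symmetric])
  ultimately have "?D #> (a [^] card S) = ?D" by simp
  then show ?thesis
    using rcos_self[OF _ D, of "a [^] card S"] a(2) by simp
qed

section \<open>Lifting a pairing to commutators\<close>

lemma (in group) commutator_eqI:
  "\<lbrakk>x \<in> carrier G; y \<in> carrier G; c \<in> carrier G; x \<otimes> y = c \<otimes> (y \<otimes> x)\<rbrakk> \<Longrightarrow> commutator G x y = c"
  by (simp add: commutator_def m_assoc inv_mult_cancel inv_solve_right)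

text \<open>Models the tensor square with its commutator map, and also its quotients by subgroups of
  the kernel. Generation by the values of \<open>w\<close> lets identities in \<open>L\<close> be
  checked on these values.\<close>

locale commutator_pairing = crossed_pairing +
  fixes d
  assumes d_hom: "d \<in> hom L G"
    and d_w [simp]: "g \<in> carrier G \<Longrightarrow> h \<in> carrier G \<Longrightarrow> d (w g h) = commutator G g h"
    and generated: "carrier L = generate L {w g h | g h. g \<in> carrier G \<and> h \<in> carrier G}"
begin

sublocale d: group_hom L G d
  by (intro group_hom.intro group_hom_axioms.intro d_hom L.group_axioms G.group_axioms)

lemma conj_by_w:
  assumes "t \<in> carrier L" "a \<in> carrier G" "b \<in> carrier G"
  shows "conj_by L t (w a b) = w (conj_by G (d t) a) (conj_by G (d t) b)"
  using assms unfolding generated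
proof (induction arbitrary: a b)
  case (incl h)
  then show ?case by (auto simp: w_conj)
next
  case (inv h)
  let ?a = "conj_by G (d (inv\<^bsub>L\<^esub> h)) a" and ?b = "conj_by G (d (inv\<^bsub>L\<^esub> h)) b"
  obtain x y where xy: "x \<in> carrier G" "y \<in> carrier G" "h = w x y" using inv by blast
  then have "conj_by L h (w ?a ?b) = w a b"
    using inv.prems by (simp add: w_conj G.commutator_closed)
  then have "conj_by L (inv\<^bsub>L\<^esub> h) (w a b) = conj_by L (inv\<^bsub>L\<^esub> h) (conj_by L h (w ?a ?b))" by simp
  also have "\<dots> = w ?a ?b" using xy inv.prems by (simp add: G.commutator_closed)
  finally show ?case .
next
  case (eng s t)
  then have "s \<in> carrier L" "t \<in> carrier L" by (simp_all flip: generated)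
  with eng show ?case by (simp add: L.conj_by_mult_left G.conj_by_mult_left)
qed simp_all

text \<open>Both sides obey the same product rule in \<open>t\<close>, so generators suffice; for
  these \<open>w_commutator_left\<close> and \<open>conj_by_w\<close> give the claim.\<close>

lemma commutator_w:
  assumes "t \<in> carrier L" "s \<in> carrier L"
  shows "commutator L t s = w (d t) (d s)"
proof -
  have gen: "h \<in> carrier L \<and> w (d h) (d s) = commutator L h s"
    if "h \<in> {w g h | g h. g \<in> carrier G \<and> h \<in> carrier G}" for h
  proof -
    from that obtain x y where xy: "x \<in> carrier G" "y \<in> carrier G" "h = w x y" by blast
    then show ?thesis
      using assms(2) L.commutator_eq(1)[of h s]
      by (simp add: w_commutator_left conj_by_w[symmetric] L.conj_by_inv)
  qed
  show ?thesis
    using assms(1) unfolding generated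
  proof induction
    case one
    then show ?case using assms(2) by (simp add: commutator_def)
  next
    case (incl h)
    from gen[OF this] show ?case by simp
  next
    case (inv h)
    from gen[OF this] have h: "h \<in> carrier L" and wh: "w (d h) (d s) = commutator L h s" by simp_all
    have "w (d (inv\<^bsub>L\<^esub> h) \<otimes>\<^bsub>G\<^esub> d h) (d s) = conj_by L (inv\<^bsub>L\<^esub> h) (w (d h) (d s)) \<otimes>\<^bsub>L\<^esub> w (d (inv\<^bsub>L\<^esub> h)) (d s)"
      using h assms(2) by (subst w_mult_left) (simp_all add: conj_by_w)
    then have "conj_by L (inv\<^bsub>L\<^esub> h) (commutator L h s) \<otimes>\<^bsub>L\<^esub> w (d (inv\<^bsub>L\<^esub> h)) (d s) = \<one>\<^bsub>L\<^esub>"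
      using h assms(2) by (simp add: wh)
    then have "inv\<^bsub>L\<^esub> w (d (inv\<^bsub>L\<^esub> h)) (d s) = conj_by L (inv\<^bsub>L\<^esub> h) (commutator L h s)"
      by (rule L.inv_equality) (use h assms(2) in \<open>simp_all add: L.commutator_closed\<close>)
    then have "inv\<^bsub>L\<^esub> (inv\<^bsub>L\<^esub> w (d (inv\<^bsub>L\<^esub> h)) (d s)) = inv\<^bsub>L\<^esub> conj_by L (inv\<^bsub>L\<^esub> h) (commutator L h s)"
      by (rule arg_cong)
    then have "w (d (inv\<^bsub>L\<^esub> h)) (d s) = inv\<^bsub>L\<^esub> conj_by L (inv\<^bsub>L\<^esub> h) (commutator L h s)"
      using h assms(2) by simp
    also have "\<dots> = commutator L (inv\<^bsub>L\<^esub> h) s"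
      using h assms(2)
      by (simp add: commutator_def conj_by_def L.m_assoc L.inv_mult_group L.inv_mult_cancel)
    finally show ?case by simp
  next
    case (eng t t')
    then have c: "t \<in> carrier L" "t' \<in> carrier L" by (simp_all flip: generated)
    then have "w (d (t \<otimes>\<^bsub>L\<^esub> t')) (d s) = conj_by L t (commutator L t' s) \<otimes>\<^bsub>L\<^esub> commutator L t s"
      using eng.IH assms(2) by (simp add: w_mult_left conj_by_w)
    also have "\<dots> = commutator L (t \<otimes>\<^bsub>L\<^esub> t') s"
      using c assms(2) by (simp add: commutator_def conj_by_def L.m_assoc L.inv_mult_group L.inv_mult_cancel)
    finally show ?case by simp
  qed
qed

text \<open>By \<open>commutator_w\<close>, a commutator with \<open>m\<close> is a value of
  \<open>w\<close> at \<open>\<one>\<close>.\<close>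

lemma kernel_central:
  assumes "m \<in> kernel L G d" "t \<in> carrier L"
  shows "m \<otimes>\<^bsub>L\<^esub> t = t \<otimes>\<^bsub>L\<^esub> m"
proof -
  have m: "m \<in> carrier L" "d m = \<one>\<^bsub>G\<^esub>" using assms by (simp_all add: kernel_def)
  then have "commutator L m t = \<one>\<^bsub>L\<^esub>" using assms(2) by (simp add: commutator_w)
  then show ?thesis using L.commutator_mult[OF m(1) assms(2)] m assms(2) by simp
qed

lemma kernel_subgroup_normal:
  assumes H: "subgroup H L" "H \<subseteq> kernel L G d"
  shows "H \<lhd> L"
proof (rule L.normal_invI[OF H(1)])
  fix t h assume t: "t \<in> carrier L" and h: "h \<in> H"
  then have "t \<otimes>\<^bsub>L\<^esub> h = h \<otimes>\<^bsub>L\<^esub> t" "h \<in> carrier L"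
    using kernel_central[of h t] H subgroup.subset by (auto simp: subset_iff)
  then show "t \<otimes>\<^bsub>L\<^esub> h \<otimes>\<^bsub>L\<^esub> inv\<^bsub>L\<^esub> t \<in> H" using t h by (simp add: L.m_assoc)
qed

text \<open>\<open>d\<close> kills \<open>H\<close> and so factors through the quotient, and
  generation passes along the projection. This serves to divide by Delta(G) and then by the diagonal
  values.\<close>

lemma quotient:
  assumes H: "subgroup H L" "H \<subseteq> kernel L G d"
  obtains d' where "commutator_pairing G (L Mod H) (\<lambda>g h. H #>\<^bsub>L\<^esub> w g h) d'"
    and "\<And>t. t \<in> carrier L \<Longrightarrow> d' (H #>\<^bsub>L\<^esub> t) = d t"
proof -
  interpret H: normal H L using H by (rule kernel_subgroup_normal)
  interpret q: crossed_pairing G "L Mod H" "\<lambda>g h. H #>\<^bsub>L\<^esub> w g h"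
    by (rule crossed_pairing_quotient) (rule H.normal_axioms)
  obtain d' where d': "d' \<in> hom (L Mod H) G" "\<And>t. t \<in> carrier L \<Longrightarrow> d' (H #>\<^bsub>L\<^esub> t) = d t"
    using d.FactGroup_universal_kernel[OF H.normal_axioms H(2)] by blast
  interpret r: group_hom L "L Mod H" "\<lambda>t. H #>\<^bsub>L\<^esub> t"
    by (intro group_hom.intro group_hom_axioms.intro L.group_axioms q.L.group_axioms H.r_coset_hom_Mod)
  let ?S = "{w g h | g h. g \<in> carrier G \<and> h \<in> carrier G}"
  have "carrier (L Mod H) = (\<lambda>t. H #>\<^bsub>L\<^esub> t) ` generate L ?S"
    by (simp add: carrier_FactGroup flip: generated)
  also have "\<dots> = generate (L Mod H) ((\<lambda>t. H #>\<^bsub>L\<^esub> t) ` ?S)"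
    by (rule r.generate_img[symmetric]) auto
  also have "(\<lambda>t. H #>\<^bsub>L\<^esub> t) ` ?S = {H #>\<^bsub>L\<^esub> w g h | g h. g \<in> carrier G \<and> h \<in> carrier G}"
    by blast
  finally have "commutator_pairing G (L Mod H) (\<lambda>g h. H #>\<^bsub>L\<^esub> w g h) d'"
    by unfold_locales (use d' in simp_all)
  then show thesis using d' that by blast
qed

end

locale alternating_commutator_pairing = alternating_pairing + commutator_pairing

text \<open>In \<open>E\<close> the pairing values become commutators, which brings \<open>L\<close>
  within reach of the transfer. Surjectivity of \<open>\<pi>\<close> is left out of the axioms so
  that its image can be enlarged one element at a time.\<close>

locale commutator_lifting =
  alternating_commutator_pairing G L w d + E: group E + pi: group_hom E G \<pi> + iota: group_hom L E \<iota>
  for G :: "('a, 'b) monoid_scheme" and L :: "('c, 'd) monoid_scheme" and w d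
    and E :: "('e, 'f) monoid_scheme" and \<pi> \<iota> +
  assumes iota_inj: "inj_on \<iota> (carrier L)"
    and pi_iota [simp]: "t \<in> carrier L \<Longrightarrow> \<pi> (\<iota> t) = d t"
    and commutator_E: "\<lbrakk>x \<in> carrier E; y \<in> carrier E\<rbrakk> \<Longrightarrow> commutator E x y = \<iota> (w (\<pi> x) (\<pi> y))"
begin

lemma E_swap:
  assumes "x \<in> carrier E" "y \<in> carrier E"
  shows "x \<otimes>\<^bsub>E\<^esub> y = \<iota> (w (\<pi> x) (\<pi> y)) \<otimes>\<^bsub>E\<^esub> (y \<otimes>\<^bsub>E\<^esub> x)"
  using assms E.commutator_mult[of x y] by (simp add: commutator_E)

text \<open>The commutator of \<open>x\<close> and \<open>\<iota> (w a b)\<close> comes from pairing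
  \<open>\<pi> x\<close> with the commutator of \<open>a\<close> and \<open>b\<close>, which
  \<open>w_commutator_left\<close> evaluates after a swap.\<close>

lemma E_iota_w:
  assumes x: "x \<in> carrier E" and a: "a \<in> carrier G" and b: "b \<in> carrier G"
  shows "x \<otimes>\<^bsub>E\<^esub> \<iota> (w a b) = \<iota> (w (conj_by G (\<pi> x) a) (conj_by G (\<pi> x) b)) \<otimes>\<^bsub>E\<^esub> x"
proof -
  have "w (\<pi> x) (commutator G a b) = inv\<^bsub>L\<^esub> w (commutator G a b) (\<pi> x)"
    using x a b by (intro w_swap) (simp_all add: G.commutator_closed)
  also have "\<dots> = w (conj_by G (\<pi> x) a) (conj_by G (\<pi> x) b) \<otimes>\<^bsub>L\<^esub> inv\<^bsub>L\<^esub> w a b"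
    using x a b by (simp add: w_commutator_left L.inv_mult_group)
  finally have "x \<otimes>\<^bsub>E\<^esub> \<iota> (w a b)
      = \<iota> (w (conj_by G (\<pi> x) a) (conj_by G (\<pi> x) b) \<otimes>\<^bsub>L\<^esub> inv\<^bsub>L\<^esub> w a b) \<otimes>\<^bsub>E\<^esub> (\<iota> (w a b) \<otimes>\<^bsub>E\<^esub> x)"
    using E_swap[of x "\<iota> (w a b)"] x a b by simp
  also have "\<dots> = \<iota> (w (conj_by G (\<pi> x) a) (conj_by G (\<pi> x) b)) \<otimes>\<^bsub>E\<^esub> x"
    using x a b by (simp add: E.m_assoc E.inv_mult_cancel del: iota.hom_inv) (simp add: E.inv_mult_cancel)
  finally show ?thesis .
qed

end

text \<open>The semidirect product of \<open>E\<close> with the integers, the generator acting as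
  \<open>x \<mapsto> \<iota> (w g (\<pi> x)) \<otimes> x\<close>; the functions \<open>mk\<close>, \<open>num\<close> and \<open>elt\<close> code pairs inside one type, so that
  the construction can be iterated.\<close>

locale commutator_lifting_step = commutator_lifting G L w d E \<pi> \<iota>
  for G :: "('a, 'b) monoid_scheme" and L :: "('c, 'd) monoid_scheme" and w d
    and E :: "('e, 'f) monoid_scheme" and \<pi> \<iota> +
  fixes g and mk :: "int \<Rightarrow> 'e \<Rightarrow> 'e" and num :: "'e \<Rightarrow> int" and elt :: "'e \<Rightarrow> 'e"
  assumes g: "g \<in> carrier G" and num [simp]: "num (mk i x) = i" and elt [simp]: "elt (mk i x) = x"
begin

text \<open>Here \<open>mk i x\<close> stands for x t^i, where t is a new generator lying over
  \<open>g\<close>; the middle factor of a product comes from moving t^i past the second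
  element.\<close>

definition ext :: "'e monoid" where
  "ext = \<lparr>carrier = (\<lambda>(i, x). mk i x) ` (UNIV \<times> carrier E),
     monoid.mult = (\<lambda>x y. mk (num x + num y)
       (elt x \<otimes>\<^bsub>E\<^esub> (\<iota> (w (g [^]\<^bsub>G\<^esub> num x) (\<pi> (elt y))) \<otimes>\<^bsub>E\<^esub> elt y))),
     one = mk 0 \<one>\<^bsub>E\<^esub>\<rparr>"

definition ext_pi :: "'e \<Rightarrow> 'a" where "ext_pi x = \<pi> (elt x) \<otimes>\<^bsub>G\<^esub> g [^]\<^bsub>G\<^esub> num x"

definition ext_iota :: "'c \<Rightarrow> 'e" where "ext_iota t = mk 0 (\<iota> t)"

lemma ext_carrier: "x \<in> carrier ext \<longleftrightarrow> (\<exists>i. \<exists>y\<in>carrier E. x = mk i y)"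
  by (auto simp: ext_def)

lemma mk_in_ext [simp]: "y \<in> carrier E \<Longrightarrow> mk i y \<in> carrier ext"
  by (auto simp: ext_carrier)

lemma ext_one: "\<one>\<^bsub>ext\<^esub> = mk 0 \<one>\<^bsub>E\<^esub>"
  by (simp add: ext_def)

lemma ext_mult: "mk i x \<otimes>\<^bsub>ext\<^esub> mk j y =
    mk (i + j) (x \<otimes>\<^bsub>E\<^esub> (\<iota> (w (g [^]\<^bsub>G\<^esub> i) (\<pi> y)) \<otimes>\<^bsub>E\<^esub> y))"
  by (simp add: ext_def)

lemma g_pow [simp]: "g [^]\<^bsub>G\<^esub> (i::int) \<in> carrier G"
  using g by simp

lemma g_pow_conj: "conj_by G (g [^]\<^bsub>G\<^esub> (i::int)) (g [^]\<^bsub>G\<^esub> (j::int)) = g [^]\<^bsub>G\<^esub> j"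
  using g by (simp add: G.conj_by_eq_iff_commute add.commute flip: G.int_pow_mult)

text \<open>Associativity says that the powers of t act by automorphisms, compatibly with addition
  of exponents: fact \<open>2\<close> gives the former, fact \<open>3\<close> the latter.\<close>

lemma ext_assoc:
  assumes x: "x \<in> carrier E" and y: "y \<in> carrier E" and z: "z \<in> carrier E"
  shows "mk i x \<otimes>\<^bsub>ext\<^esub> mk j y \<otimes>\<^bsub>ext\<^esub> mk k z = mk i x \<otimes>\<^bsub>ext\<^esub> (mk j y \<otimes>\<^bsub>ext\<^esub> mk k z)"
proof -
  let ?a = "g [^]\<^bsub>G\<^esub> i" and ?b = "g [^]\<^bsub>G\<^esub> j" and ?Z = "\<pi> z"
  let ?bZ = "conj_by G ?b ?Z"
  have 1: "\<pi> (y \<otimes>\<^bsub>E\<^esub> (\<iota> (w ?b ?Z) \<otimes>\<^bsub>E\<^esub> z)) = \<pi> y \<otimes>\<^bsub>G\<^esub> ?bZ"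
    using y z by (simp add: G.commutator_eq(2) G.m_assoc)
  have 2: "\<iota> (w ?a (\<pi> y \<otimes>\<^bsub>G\<^esub> ?bZ)) \<otimes>\<^bsub>E\<^esub> y = \<iota> (w ?a (\<pi> y)) \<otimes>\<^bsub>E\<^esub> (y \<otimes>\<^bsub>E\<^esub> \<iota> (w ?a ?bZ))"
    using y z E_iota_w[of y ?a ?bZ] by (simp add: w_mult_right E.m_assoc)
  have "w (g [^]\<^bsub>G\<^esub> (i + j)) ?Z = w (?b \<otimes>\<^bsub>G\<^esub> ?a) ?Z"
    using g by (simp add: add.commute flip: G.int_pow_mult)
  also have "\<dots> = w ?a ?bZ \<otimes>\<^bsub>L\<^esub> w ?b ?Z"
    using z by (simp add: w_mult_left g_pow_conj)
  finally have 3: "w (g [^]\<^bsub>G\<^esub> (i + j)) ?Z = w ?a ?bZ \<otimes>\<^bsub>L\<^esub> w ?b ?Z" .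
  have "\<iota> (w ?a (\<pi> y \<otimes>\<^bsub>G\<^esub> ?bZ)) \<otimes>\<^bsub>E\<^esub> (y \<otimes>\<^bsub>E\<^esub> (\<iota> (w ?b ?Z) \<otimes>\<^bsub>E\<^esub> z))
      = (\<iota> (w ?a (\<pi> y \<otimes>\<^bsub>G\<^esub> ?bZ)) \<otimes>\<^bsub>E\<^esub> y) \<otimes>\<^bsub>E\<^esub> (\<iota> (w ?b ?Z) \<otimes>\<^bsub>E\<^esub> z)"
    using y z by (simp add: E.m_assoc)
  then show ?thesis
    using x y z by (simp add: ext_mult 1 2 3 E.m_assoc add.assoc)
qed

lemma group_ext: "group ext"
proof (rule groupI)
  fix x assume "x \<in> carrier ext"
  then obtain i x' where x: "x' \<in> carrier E" "x = mk i x'" unfolding ext_carrier by blast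
  show "\<one>\<^bsub>ext\<^esub> \<otimes>\<^bsub>ext\<^esub> x = x" using x by (simp add: ext_one ext_mult)
  \<comment> \<open>Multiplying \<open>mk (- i) y\<close> by \<open>x\<close> gives the second
    component \<open>y\<close> times \<open>?u\<close>, so the inverse of \<open>?u\<close> is the
    right choice of \<open>y\<close>.\<close>
  let ?u = "\<iota> (w (g [^]\<^bsub>G\<^esub> (- i)) (\<pi> x')) \<otimes>\<^bsub>E\<^esub> x'"
  have "?u \<in> carrier E" using x g by (intro E.m_closed iota.hom_closed w_closed) auto
  then show "\<exists>y\<in>carrier ext. y \<otimes>\<^bsub>ext\<^esub> x = \<one>\<^bsub>ext\<^esub>"
    using x by (intro bexI[of _ "mk (- i) (inv\<^bsub>E\<^esub> ?u)"]) (simp_all only: ext_mult ext_one E.l_inv mk_in_ext E.inv_closed add.left_inverse)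
  fix y assume "y \<in> carrier ext"
  then obtain j y' where y: "y' \<in> carrier E" "y = mk j y'" unfolding ext_carrier by blast
  show "x \<otimes>\<^bsub>ext\<^esub> y \<in> carrier ext" using x y by (simp add: ext_mult)
  fix z assume "z \<in> carrier ext"
  then obtain k z' where z: "z' \<in> carrier E" "z = mk k z'" unfolding ext_carrier by blast
  show "x \<otimes>\<^bsub>ext\<^esub> y \<otimes>\<^bsub>ext\<^esub> z = x \<otimes>\<^bsub>ext\<^esub> (y \<otimes>\<^bsub>ext\<^esub> z)" using x y z by (simp add: ext_assoc)
qed (simp add: ext_one)

lemma ext_pi_mk: "ext_pi (mk i x) = \<pi> x \<otimes>\<^bsub>G\<^esub> g [^]\<^bsub>G\<^esub> i"
  by (simp add: ext_pi_def)

lemma ext_pi_hom: "ext_pi \<in> hom ext G"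
proof (rule homI)
  fix x assume "x \<in> carrier ext"
  then obtain i x' where x: "x' \<in> carrier E" "x = mk i x'" unfolding ext_carrier by blast
  show "ext_pi x \<in> carrier G" using x by (simp add: ext_pi_mk)
  fix y assume "y \<in> carrier ext"
  then obtain j y' where y: "y' \<in> carrier E" "y = mk j y'" unfolding ext_carrier by blast
  show "ext_pi (x \<otimes>\<^bsub>ext\<^esub> y) = ext_pi x \<otimes>\<^bsub>G\<^esub> ext_pi y"
    using x y g
    by (simp add: ext_pi_mk ext_mult G.commutator_eq(2) conj_by_def G.m_assoc G.inv_mult_cancel G.int_pow_mult)
qed

lemma ext_iota_mult: "t \<in> carrier L \<Longrightarrow> x \<in> carrier E \<Longrightarrow> ext_iota t \<otimes>\<^bsub>ext\<^esub> mk i x = mk i (\<iota> t \<otimes>\<^bsub>E\<^esub> x)"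
  by (simp add: ext_iota_def ext_mult)

lemma ext_iota_hom: "ext_iota \<in> hom L ext"
  by (rule homI) (simp_all add: ext_iota_def ext_mult)

text \<open>The pairing expands into four factors. The one on powers of \<open>g\<close> vanishes;
  the others are the commutator of \<open>x\<close> and \<open>y\<close> in \<open>E\<close> and the
  two twists from \<open>ext_mult\<close>.\<close>

lemma ext_swap:
  assumes x: "x \<in> carrier E" and y: "y \<in> carrier E"
  shows "mk i x \<otimes>\<^bsub>ext\<^esub> mk j y
    = ext_iota (w (ext_pi (mk i x)) (ext_pi (mk j y))) \<otimes>\<^bsub>ext\<^esub> (mk j y \<otimes>\<^bsub>ext\<^esub> mk i x)"
proof -
  let ?a = "g [^]\<^bsub>G\<^esub> i" and ?b = "g [^]\<^bsub>G\<^esub> j" and ?X = "\<pi> x" and ?Y = "\<pi> y" and ?c = "conj_by G"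
  have X: "?X \<in> carrier G" "?Y \<in> carrier G" using x y by auto
  have "w (?X \<otimes>\<^bsub>G\<^esub> ?a) (?Y \<otimes>\<^bsub>G\<^esub> ?b)
      = w (?X \<otimes>\<^bsub>G\<^esub> ?a) ?Y \<otimes>\<^bsub>L\<^esub> w (?c ?Y ?X \<otimes>\<^bsub>G\<^esub> ?c ?Y ?a) (?c ?Y ?b)"
    using X by (subst w_mult_right) (simp_all add: G.conj_by_mult_right)
  also have "w (?c ?Y ?X \<otimes>\<^bsub>G\<^esub> ?c ?Y ?a) (?c ?Y ?b)
      = w (?c ?Y (?c ?X ?a)) (?c ?Y (?c ?X ?b)) \<otimes>\<^bsub>L\<^esub> w (?c ?Y ?X) (?c ?Y ?b)"
    using X by (subst w_mult_left) (simp_all add: G.conj_by_conj_by)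
  \<comment> \<open>This is \<open>w ?a ?b\<close> with both arguments conjugated by the product of
    \<open>?Y\<close> and \<open>?X\<close>. As the powers commute, the conjugation has no effect,
    and \<open>w_cyclic\<close> applies.\<close>
  also have "w (?c ?Y (?c ?X ?a)) (?c ?Y (?c ?X ?b)) = \<one>\<^bsub>L\<^esub>"
  proof -
    have "commutator G ?a ?b = \<one>\<^bsub>G\<^esub>" by (simp add: G.commutator_eq(2) g_pow_conj)
    then have "inv\<^bsub>L\<^esub> w (?c (?Y \<otimes>\<^bsub>G\<^esub> ?X) ?a) (?c (?Y \<otimes>\<^bsub>G\<^esub> ?X) ?b) = \<one>\<^bsub>L\<^esub>"
      using w_commutator_left[of ?a ?b "?Y \<otimes>\<^bsub>G\<^esub> ?X"] X g by (simp add: w_cyclic)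
    then show ?thesis using X by (simp add: G.conj_by_mult_left L.inv_eq_1_iff)
  qed
  finally have 1: "w (?X \<otimes>\<^bsub>G\<^esub> ?a) (?Y \<otimes>\<^bsub>G\<^esub> ?b) \<otimes>\<^bsub>L\<^esub> w (?c ?Y ?b) (?c ?Y ?X) = w (?X \<otimes>\<^bsub>G\<^esub> ?a) ?Y"
    using X w_swap[of "?c ?Y ?X" "?c ?Y ?b"] by (simp add: L.m_assoc)
  have 2: "w (?X \<otimes>\<^bsub>G\<^esub> ?a) ?Y = w (?c ?X ?a) (?c ?X ?Y) \<otimes>\<^bsub>L\<^esub> w ?X ?Y"
    using X by (simp add: w_mult_left)
  have "x \<otimes>\<^bsub>E\<^esub> (\<iota> (w ?a ?Y) \<otimes>\<^bsub>E\<^esub> y) = \<iota> (w (?c ?X ?a) (?c ?X ?Y)) \<otimes>\<^bsub>E\<^esub> (x \<otimes>\<^bsub>E\<^esub> y)"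
    using x y E_iota_w[of x ?a ?Y] by (simp flip: E.m_assoc)
  also have "\<dots> = \<iota> (w (?X \<otimes>\<^bsub>G\<^esub> ?a) ?Y) \<otimes>\<^bsub>E\<^esub> (y \<otimes>\<^bsub>E\<^esub> x)"
    using x y X by (simp add: 2 E_swap[of x y] E.m_assoc)
  also have "\<dots> = \<iota> (w (?X \<otimes>\<^bsub>G\<^esub> ?a) (?Y \<otimes>\<^bsub>G\<^esub> ?b)) \<otimes>\<^bsub>E\<^esub> (\<iota> (w (?c ?Y ?b) (?c ?Y ?X)) \<otimes>\<^bsub>E\<^esub> y \<otimes>\<^bsub>E\<^esub> x)"
    using x y X by (simp add: 1[symmetric] E.m_assoc)
  also have "\<iota> (w (?c ?Y ?b) (?c ?Y ?X)) \<otimes>\<^bsub>E\<^esub> y \<otimes>\<^bsub>E\<^esub> x = y \<otimes>\<^bsub>E\<^esub> (\<iota> (w ?b ?X) \<otimes>\<^bsub>E\<^esub> x)"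
    using x y X E_iota_w[of y ?b ?X] by (simp flip: E.m_assoc)
  finally show ?thesis
    using x y by (simp add: ext_mult ext_pi_mk ext_iota_mult add.commute)
qed

lemma commutator_lifting_ext: "commutator_lifting G L w d ext ext_pi ext_iota"
proof -
  interpret X: group ext by (rule group_ext)
  show ?thesis
  proof unfold_locales
    show "ext_pi \<in> hom ext G" "ext_iota \<in> hom L ext" by (rule ext_pi_hom ext_iota_hom)+
    show "inj_on ext_iota (carrier L)"
    proof (rule inj_onI)
      fix s t assume st: "s \<in> carrier L" "t \<in> carrier L" and "ext_iota s = ext_iota t"
      then have "elt (mk 0 (\<iota> s)) = elt (mk 0 (\<iota> t))" by (simp only: ext_iota_def)
      then show "s = t" using st iota_inj by (simp add: inj_on_eq_iff)
    qed
    show "ext_pi (ext_iota t) = d t" if "t \<in> carrier L" for t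
      using that by (simp add: ext_iota_def ext_pi_mk)
    fix x y assume xy: "x \<in> carrier ext" "y \<in> carrier ext"
    have c: "ext_pi u \<in> carrier G" if "u \<in> carrier ext" for u
      using ext_pi_hom that by (rule hom_in_carrier)
    show "commutator ext x y = ext_iota (w (ext_pi x) (ext_pi y))"
    proof (rule X.commutator_eqI[OF xy])
      show "ext_iota (w (ext_pi x) (ext_pi y)) \<in> carrier ext"
        using ext_iota_hom by (rule hom_in_carrier) (simp add: c xy)
      show "x \<otimes>\<^bsub>ext\<^esub> y = ext_iota (w (ext_pi x) (ext_pi y)) \<otimes>\<^bsub>ext\<^esub> (y \<otimes>\<^bsub>ext\<^esub> x)"
      proof -
        obtain i x' j y' where *: "x' \<in> carrier E" "x = mk i x'" "y' \<in> carrier E" "y = mk j y'"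
          using xy unfolding ext_carrier by blast
        show ?thesis unfolding *(2,4) using *(1,3) by (rule ext_swap)
      qed
    qed
  qed
qed

lemma image_subset_ext_pi: "\<pi> ` carrier E \<subseteq> ext_pi ` carrier ext"
proof
  fix h assume "h \<in> \<pi> ` carrier E"
  then obtain x where x: "x \<in> carrier E" "h = \<pi> x" by blast
  show "h \<in> ext_pi ` carrier ext"
    using x by (intro image_eqI[of _ _ "mk 0 x"]) (simp_all add: ext_pi_mk)
qed

lemma g_in_ext_pi: "g \<in> ext_pi ` carrier ext"
  using g by (intro image_eqI[of _ _ "mk 1 \<one>\<^bsub>E\<^esub>"]) (simp_all add: ext_pi_mk)

end

section \<open>Liftings that cover a given finite set\<close>

context alternating_commutator_pairing
begin

text \<open>Lifts are adjoined one element at a time, starting from a copy of \<open>L\<close>,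
  whose commutators are given by \<open>commutator_w\<close>. The lists keep the type fixed: each
  adjunction prepends one integer.\<close>

lemma commutator_lifting_exists_subset:
  assumes "finite X" "X \<subseteq> carrier G"
  shows "\<exists>(E :: ('c \<times> int list) monoid) \<pi> \<iota>. commutator_lifting G L w d E \<pi> \<iota> \<and> X \<subseteq> \<pi> ` carrier E"
  using assms
proof (induction X)
  case empty
  define E :: "('c \<times> int list) monoid" where "E = \<lparr>carrier = (\<lambda>t. (t, [])) ` carrier L,
    monoid.mult = (\<lambda>x y. (fst x \<otimes>\<^bsub>L\<^esub> fst y, [])), one = (\<one>\<^bsub>L\<^esub>, [])\<rparr>"
  interpret E: group E
    by (rule groupI) (auto simp: E_def L.m_assoc intro: L.l_inv_ex)
  have "commutator_lifting G L w d E (d \<circ> fst) (\<lambda>t. (t, []))"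
  proof unfold_locales
    fix x y assume xy: "x \<in> carrier E" "y \<in> carrier E"
    then have "commutator L (fst x) (fst y) = w (d (fst x)) (d (fst y))"
      by (auto simp: E_def commutator_w)
    moreover have "fst x \<otimes>\<^bsub>L\<^esub> fst y = commutator L (fst x) (fst y) \<otimes>\<^bsub>L\<^esub> (fst y \<otimes>\<^bsub>L\<^esub> fst x)"
      using xy by (auto simp: E_def L.commutator_mult)
    ultimately show "commutator E x y = (w ((d \<circ> fst) x) ((d \<circ> fst) y), [])"
      using xy by (intro E.commutator_eqI) (auto simp: E_def)
  qed (auto simp: E_def hom_def inj_on_def)
  then show ?case by blast
next
  case (insert g X)
  then obtain E :: "('c \<times> int list) monoid" and \<pi> \<iota>
    where E: "commutator_lifting G L w d E \<pi> \<iota>" "X \<subseteq> \<pi> ` carrier E" by auto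
  interpret commutator_lifting G L w d E \<pi> \<iota> by (rule E)
  interpret commutator_lifting_step G L w d E \<pi> \<iota> g
      "\<lambda>i x. (fst x, i # snd x)" "\<lambda>x. hd (snd x)" "\<lambda>x. (fst x, tl (snd x))"
    using insert.prems by unfold_locales auto
  show ?case
    using commutator_lifting_ext image_subset_ext_pi g_in_ext_pi E(2) by (meson insert_subset subset_trans)
qed

end

section \<open>The kernel of the commutator map\<close>

text \<open>Representatives of the cosets of \<open>P\<close> in \<open>H\<close>, lifted through
  \<open>\<pi>\<close>, form a transversal of the preimage of \<open>P\<close>.\<close>

lemma (in group) exists_finite_transversal:
  assumes "finite (carrier H)" "\<pi> \<in> hom G H" "\<pi> ` carrier G = carrier H" "group H" "subgroup P H"
  obtains S where "S \<subseteq> carrier G" "finite S" "card S = card (rcosets\<^bsub>H\<^esub> P)"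
    "\<forall>x\<in>carrier G. \<exists>!s. s \<in> S \<and> x \<otimes> inv s \<in> {y \<in> carrier G. \<pi> y \<in> P}"
proof -
  interpret \<pi>: group_hom G H \<pi> using assms by (intro group_hom.intro group_hom_axioms.intro group_axioms)
  interpret P: subgroup P H by fact
  have "\<exists>x\<in>carrier G. C = P #>\<^bsub>H\<^esub> \<pi> x" if "C \<in> rcosets\<^bsub>H\<^esub> P" for C
    using that unfolding RCOSETS_def assms(3)[symmetric] by blast
  then obtain r where r: "\<And>C. C \<in> rcosets\<^bsub>H\<^esub> P \<Longrightarrow> r C \<in> carrier G \<and> C = P #>\<^bsub>H\<^esub> \<pi> (r C)"
    by metis
  let ?S = "r ` (rcosets\<^bsub>H\<^esub> P)"
  have "finite (rcosets\<^bsub>H\<^esub> P)"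
    using assms(1) \<pi>.H.rcosets_part_G[OF assms(5)] by (metis finite_UnionD)
  then have "finite ?S" by simp
  moreover have "inj_on r (rcosets\<^bsub>H\<^esub> P)" using r by (metis inj_onI)
  moreover have "\<forall>x\<in>carrier G. \<exists>!s. s \<in> ?S \<and> x \<otimes> inv s \<in> {y \<in> carrier G. \<pi> y \<in> P}"
  proof
    fix x assume x: "x \<in> carrier G"
    have iff: "x \<otimes> inv s \<in> {y \<in> carrier G. \<pi> y \<in> P} \<longleftrightarrow> P #>\<^bsub>H\<^esub> \<pi> x = P #>\<^bsub>H\<^esub> \<pi> s" if s: "s \<in> carrier G" for s
    proof -
      have "\<pi> x \<otimes>\<^bsub>H\<^esub> inv\<^bsub>H\<^esub> \<pi> s \<in> P \<longleftrightarrow> \<pi> x \<in> P #>\<^bsub>H\<^esub> \<pi> s"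
        using x s P.rcos_module[OF \<pi>.H.group_axioms] by simp
      also have "\<dots> \<longleftrightarrow> P #>\<^bsub>H\<^esub> \<pi> x = P #>\<^bsub>H\<^esub> \<pi> s"
        using x s \<pi>.H.repr_independence[OF _ _ assms(5)] \<pi>.H.rcos_self[OF _ assms(5)]
        by (metis \<pi>.hom_closed)
      finally show ?thesis using x s by simp
    qed
    let ?C = "P #>\<^bsub>H\<^esub> \<pi> x"
    have C: "?C \<in> rcosets\<^bsub>H\<^esub> P" using x by (simp add: \<pi>.H.rcosetsI P.subset)
    show "\<exists>!s. s \<in> ?S \<and> x \<otimes> inv s \<in> {y \<in> carrier G. \<pi> y \<in> P}"
    proof (rule ex1I[of _ "r ?C"])
      show "r ?C \<in> ?S \<and> x \<otimes> inv (r ?C) \<in> {y \<in> carrier G. \<pi> y \<in> P}"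
        using C r[OF C] iff[of "r ?C"] by blast
      fix s assume s: "s \<in> ?S \<and> x \<otimes> inv s \<in> {y \<in> carrier G. \<pi> y \<in> P}"
      then obtain D where D: "D \<in> rcosets\<^bsub>H\<^esub> P" "s = r D" by blast
      then have "?C = D" using s iff[of s] r[OF D(1)] by simp
      then show "s = r ?C" using D by simp
    qed
  qed
  moreover have "?S \<subseteq> carrier G" using r by blast
  ultimately show thesis by (intro that[of ?S]) (simp_all only: card_image)
qed

section \<open>Orders of kernels of alternating commutator pairings\<close>

context alternating_commutator_pairing
begin

text \<open>Transfer to the preimage \<open>?Q\<close> of \<open>P\<close> in a lifting over all of
  \<open>G\<close>. There \<open>\<iota> m\<close> is central, lies in \<open>?Q\<close> because
  \<open>d m\<close> is trivial, and is a product of commutators because pairing values generate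
  \<open>L\<close>. The derived subgroup of \<open>?Q\<close> lies in what the values of
  \<open>w\<close> on \<open>P\<close> generate.\<close>

theorem kernel_power_index:
  assumes fin: "finite (carrier G)" and P: "subgroup P G" and m: "m \<in> kernel L G d"
  shows "m [^]\<^bsub>L\<^esub> card (rcosets\<^bsub>G\<^esub> P) \<in> generate L {w x y | x y. x \<in> P \<and> y \<in> P}"
proof -
  obtain E :: "('c \<times> int list) monoid" and \<pi> \<iota>
    where E: "commutator_lifting G L w d E \<pi> \<iota>" "carrier G \<subseteq> \<pi> ` carrier E"
    using commutator_lifting_exists_subset[OF fin] by blast
  interpret commutator_lifting G L w d E \<pi> \<iota> by (rule E)
  interpret P: subgroup P G by fact
  let ?Q = "{x \<in> carrier E. \<pi> x \<in> P}" and ?S = "{w x y | x y. x \<in> P \<and> y \<in> P}"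
  have onto: "\<pi> ` carrier E = carrier G" using E(2) by auto
  obtain S where S: "S \<subseteq> carrier E" "finite S" "card S = card (rcosets\<^bsub>G\<^esub> P)"
    "\<forall>x\<in>carrier E. \<exists>!s. s \<in> S \<and> x \<otimes>\<^bsub>E\<^esub> inv\<^bsub>E\<^esub> s \<in> ?Q"
    by (rule E.exists_finite_transversal[OF fin pi.homh onto G.group_axioms P])
  have Q: "subgroup ?Q E"
  proof (rule E.subgroupI)
    have "\<one>\<^bsub>E\<^esub> \<in> ?Q" by simp
    then show "?Q \<noteq> {}" by blast
  qed auto
  have m': "m \<in> carrier L" "d m = \<one>\<^bsub>G\<^esub>" using m by (simp_all add: kernel_def)
  have derived_set: "derived_set E X = (\<Union>x\<in>X. \<Union>y\<in>X. {\<iota> (w (\<pi> x) (\<pi> y))})" if "X \<subseteq> carrier E" for X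
    using commutator_E[unfolded commutator_def, OF subsetD[OF that] subsetD[OF that]]
    by (intro SUP_cong HOL.refl) simp
  let ?W = "{w g h | g h. g \<in> carrier G \<and> h \<in> carrier G}"
  have "\<iota> ` ?W \<subseteq> derived_set E (carrier E)"
    unfolding derived_set[OF order_refl] onto[symmetric] by auto
  then have "generate E (\<iota> ` ?W) \<subseteq> derived E (carrier E)"
    unfolding derived_def by (rule E.mono_generate)
  moreover have "generate E (\<iota> ` ?W) = \<iota> ` generate L ?W" by (rule iota.generate_img) auto
  ultimately have 1: "\<iota> m \<in> derived E (carrier E)" using m'(1) unfolding generated by auto
  have 2: "\<iota> m \<in> ?Q" using m' by simp
  have 3: "\<iota> m \<otimes>\<^bsub>E\<^esub> x = x \<otimes>\<^bsub>E\<^esub> \<iota> m" if "x \<in> carrier E" for x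
    using E_swap[of "\<iota> m" x] that m' by simp
  have "\<iota> (m [^]\<^bsub>L\<^esub> card S) \<in> derived E ?Q"
    using E.transfer_central_power[OF Q S(1,2) S(4)[rule_format] 1 2 3] m' by (simp add: iota.hom_nat_pow)
  also have "derived E ?Q \<subseteq> generate E (\<iota> ` ?S)"
    unfolding derived_def by (intro E.mono_generate) (subst derived_set; auto)
  also have "\<dots> = \<iota> ` generate L ?S" by (rule iota.generate_img) auto
  finally have "\<iota> (m [^]\<^bsub>L\<^esub> card S) \<in> \<iota> ` generate L ?S" .
  then obtain t where t: "t \<in> generate L ?S" "\<iota> (m [^]\<^bsub>L\<^esub> card S) = \<iota> t" by blast
  have "t \<in> carrier L" using t(1) by (rule L.generate_in_carrier[rotated]) auto
  then have "m [^]\<^bsub>L\<^esub> card S = t" using t(2) m' iota_inj by (simp add: inj_on_eq_iff)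
  then show ?thesis using t(1) S(3) by simp
qed

text \<open>The kernel embeds into the product of the \<open>T i\<close> by taking powers with
  exponents \<open>k i\<close>, the indices of the Sylow subgroups.\<close>

theorem card_kernel_le:
  fixes n :: nat and p a :: "nat \<Rightarrow> nat"
  assumes fin: "finite (carrier G)"
    and p: "\<And>i. i < n \<Longrightarrow> Factorial_Ring.prime (p i)" and inj: "inj_on p {..<n}"
    and ord: "order G = (\<Prod>i<n. p i ^ a i)"
  shows "finite (kernel L G d)"
    and "card (kernel L G d) \<le> (\<Prod>i<n. p i ^ (a i * (a i - 1) div 2))"
proof -
  have split: "order G = p i ^ a i * (\<Prod>j\<in>{..<n} - {i}. p j ^ a j)" if "i < n" for i
    using that ord prod.remove[of "{..<n}" i "\<lambda>j. p j ^ a j"] by simp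
  have "\<exists>P. subgroup P G \<and> card P = p i ^ a i" if "i < n" for i
    using sylow_thm[OF p[OF that] G.group_axioms split[OF that] fin] .
  then obtain P where P: "\<And>i. i < n \<Longrightarrow> subgroup (P i) G" "\<And>i. i < n \<Longrightarrow> card (P i) = p i ^ a i"
    by metis
  define T where "T i = generate L {w x y | x y. x \<in> P i \<and> y \<in> P i}" for i
  have T: "finite (T i) \<and> card (T i) \<le> p i ^ (a i * (a i - 1) div 2)" if i: "i < n" for i
  proof -
    interpret S: subgroup "P i" G using P(1)[OF i] .
    interpret c: crossed_pairing "G\<lparr>carrier := P i\<rparr>" L w
      by (rule crossed_pairing_subgroup) (rule P(1)[OF i])
    interpret c: alternating_pairing "G\<lparr>carrier := P i\<rparr>" L w by unfold_locales simp
    have "T i = c.pairing_subgroup (P i)" by (simp add: T_def c.pairing_subgroup_def)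
    then show ?thesis
      using c.card_pairing_subgroup_prime_power[OF p[OF i], of "a i"] P(2)[OF i] by (simp add: order_def)
  qed
  define k where "k i = card (rcosets\<^bsub>G\<^esub> (P i))" for i
  have k: "\<not> p i dvd k i" if i: "i < n" for i
  proof
    assume dvd: "p i dvd k i"
    have "k i * p i ^ a i = (\<Prod>j\<in>{..<n} - {i}. p j ^ a j) * p i ^ a i"
      using G.lagrange[OF P(1)[OF i]] P(2)[OF i] split[OF i] by (simp add: k_def mult.commute)
    then have "k i = (\<Prod>j\<in>{..<n} - {i}. p j ^ a j)"
      using prime_gt_0_nat[OF p[OF i]] by simp
    then obtain j where j: "j < n" "j \<noteq> i" "p i dvd p j ^ a j"
      using dvd p[OF i] by (auto simp: prime_dvd_prod_iff)
    then have "p i = p j" using p i primes_dvd_imp_eq prime_dvd_power by blast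
    then show False using inj i j by (simp add: inj_on_eq_iff)
  qed
  interpret K: subgroup "kernel L G d" L by (rule d.subgroup_kernel)
  have pow_T: "m [^]\<^bsub>L\<^esub> k i \<in> T i" if "m \<in> kernel L G d" "i < n" for m i
    unfolding k_def T_def using kernel_power_index[OF fin P(1)[OF that(2)] that(1)] .
  \<comment> \<open>For the trivial subgroup the index is the order of \<open>G\<close>, so
    \<open>kernel_power_index\<close> bounds the exponent of the kernel.\<close>
  have pow_order: "m [^]\<^bsub>L\<^esub> order G = \<one>\<^bsub>L\<^esub>" if "m \<in> kernel L G d" for m
  proof -
    have "{w x y | x y. x \<in> {\<one>\<^bsub>G\<^esub>} \<and> y \<in> {\<one>\<^bsub>G\<^esub>}} = {\<one>\<^bsub>L\<^esub>}" by simp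
    then show ?thesis
      using kernel_power_index[OF fin G.triv_subgroup that] G.card_rcosets_triv[OF fin]
      by (simp add: L.generate_one)
  qed
  let ?f = "\<lambda>m. \<lambda>i\<in>{..<n}. m [^]\<^bsub>L\<^esub> k i"
  have sub: "?f ` kernel L G d \<subseteq> PiE {..<n} T"
    by (intro image_subsetI PiE_I) (simp_all add: pow_T)
  have inj_f: "inj_on ?f (kernel L G d)"
  proof (rule inj_onI)
    fix m m' assume m: "m \<in> kernel L G d" "m' \<in> kernel L G d" and eq: "?f m = ?f m'"
    let ?u = "m \<otimes>\<^bsub>L\<^esub> inv\<^bsub>L\<^esub> m'"
    have u: "?u \<in> kernel L G d" "?u \<in> carrier L" using m by auto
    have uk: "?u [^]\<^bsub>L\<^esub> k i = \<one>\<^bsub>L\<^esub>" if "i < n" for i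
    proof -
      have "?u [^]\<^bsub>L\<^esub> k i = m [^]\<^bsub>L\<^esub> k i \<otimes>\<^bsub>L\<^esub> inv\<^bsub>L\<^esub> m' [^]\<^bsub>L\<^esub> k i"
        using m kernel_central by (intro L.pow_mult_distrib) auto
      also have "m [^]\<^bsub>L\<^esub> k i = m' [^]\<^bsub>L\<^esub> k i" using fun_cong[OF eq, of i] that by simp
      finally show ?thesis using m by (simp add: L.nat_pow_inv)
    qed
    \<comment> \<open>A prime dividing the order of \<open>?u\<close> divides that of
      \<open>G\<close>, so it is some \<open>p i\<close>; but it also divides \<open>k i\<close>,
      which is prime to \<open>p i\<close>.\<close>
    have "L.ord ?u = 1"
    proof (rule ccontr)
      assume "L.ord ?u \<noteq> 1"
      then obtain q where q: "Factorial_Ring.prime q" "q dvd L.ord ?u" using prime_factor_nat by blast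
      have "q dvd (\<Prod>i<n. p i ^ a i)"
        using pow_order[OF u(1)] q(2) u(2) ord by (metis L.pow_eq_id dvd_trans)
      then obtain i where i: "i < n" "q dvd p i ^ a i" using q(1) by (auto simp: prime_dvd_prod_iff)
      then have "q = p i" using q(1) p primes_dvd_imp_eq prime_dvd_power by blast
      moreover have "q dvd k i" using uk[OF i(1)] q(2) u(2) by (metis L.pow_eq_id dvd_trans)
      ultimately show False using k[OF i(1)] by simp
    qed
    then have "?u = \<one>\<^bsub>L\<^esub>" using u(2) L.ord_eq_1 by blast
    then show "m = m'" using m by (metis K.mem_carrier L.inv_closed L.inv_equality L.inv_inv)
  qed
  have finT: "finite (PiE {..<n} T)" using T by (intro finite_PiE) auto
  show "finite (kernel L G d)"
    using inj_f finT sub by (meson finite_imageD finite_subset)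
  have "card (kernel L G d) \<le> card (PiE {..<n} T)"
    using inj_f sub finT by (rule card_inj_on_le)
  also have "\<dots> = (\<Prod>i<n. card (T i))" by (simp add: card_PiE)
  also have "\<dots> \<le> (\<Prod>i<n. p i ^ (a i * (a i - 1) div 2))" using T by (intro prod_mono) auto
  finally show "card (kernel L G d) \<le> (\<Prod>i<n. p i ^ (a i * (a i - 1) div 2))" .
qed

end

section \<open>The tensor square\<close>

text \<open>The class of a word is the product of the classes of its letters, and by
  \<open>word_rel.cancel\<close> the class of a formal inverse is the inverse of a
  generator.\<close>

lemma presented_group_generated:
  "carrier (presented_group X R) = generate (presented_group X R) (presented_gen X R ` X)"
proof -
  let ?P = "presented_group X R" and ?c = "\<lambda>u. word_rel X R `` {u}"
  interpret P: group ?P by (rule group_presented_group)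
  have car: "carrier ?P = ?c ` words X"
    by (auto simp: presented_group_def quotient_def)
  have one: "\<one>\<^bsub>?P\<^esub> = ?c []" by (simp add: presented_group_def)
  have gen: "presented_gen X R ` X \<subseteq> carrier ?P"
    by (auto simp: car presented_gen_def)
  have letter: "?c [(x, b)] \<in> generate ?P (presented_gen X R ` X)" if x: "x \<in> X" for x b
  proof (cases b)
    case True
    then show ?thesis using x by (auto simp: presented_gen_def intro: generate.incl)
  next
    case False
    have "?c [(x, False)] \<otimes>\<^bsub>?P\<^esub> ?c [(x, True)] = \<one>\<^bsub>?P\<^esub>"
      using x equiv_class_eq[OF equiv_word_rel word_rel.cancel[OF x, of False R]]
      by (simp add: presented_mult_class one)
    then have "?c [(x, False)] = inv\<^bsub>?P\<^esub> presented_gen X R x"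
      unfolding presented_gen_def using x by (intro P.inv_equality[symmetric]) (auto simp: car)
    then show ?thesis using x False by (auto intro: generate.inv)
  qed
  have "?c u \<in> generate ?P (presented_gen X R ` X)" if "u \<in> words X" for u
    using that
  proof (induction u)
    case Nil
    then show ?case by (metis one generate.one)
  next
    case (Cons l u)
    obtain x b where l: "l = (x, b)" by (cases l)
    then have "?c (l # u) = ?c [(x, b)] \<otimes>\<^bsub>?P\<^esub> ?c u"
      using Cons.prems by (simp add: presented_mult_class)
    then show ?case using Cons l letter by (auto intro: generate.eng)
  qed
  then show ?thesis using P.generate_incl[OF gen] by (auto simp: car)
qed

section \<open>The tensor square as a commutator pairing\<close>

context group
begin

lemma tensor_relation_class:
  assumes "(u, v) \<in> tensor_relations G" "u \<in> words (carrier G \<times> carrier G)" "v \<in> words (carrier G \<times> carrier G)"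
  shows "word_rel (carrier G \<times> carrier G) (tensor_relations G) `` {u}
    = word_rel (carrier G \<times> carrier G) (tensor_relations G) `` {v}"
  using equiv_class_eq[OF equiv_word_rel word_rel.relation[OF assms]] .

lemma tensor_mult_tensor:
  assumes "a \<in> carrier G" "b \<in> carrier G" "c \<in> carrier G" "e \<in> carrier G"
  shows "tensor G a b \<otimes>\<^bsub>tensor_square G\<^esub> tensor G c e
    = word_rel (carrier G \<times> carrier G) (tensor_relations G) `` {[((a, b), True), ((c, e), True)]}"
  unfolding tensor_def tensor_square_def presented_gen_def
  using assms by (subst presented_mult_class) simp_all

lemma commutator_pairing_tensor:
  "commutator_pairing G (tensor_square G) (tensor G) (tensor_commutator G)"
proof -
  let ?X = "carrier G \<times> carrier G"
  interpret T: group "tensor_square G" by (rule group_tensor_square)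
  have gen: "{tensor G g h | g h. g \<in> carrier G \<and> h \<in> carrier G} = presented_gen ?X (tensor_relations G) ` ?X"
    by (auto simp: tensor_def)
  have carrier: "carrier (tensor_square G)
      = generate (tensor_square G) {tensor G g h | g h. g \<in> carrier G \<and> h \<in> carrier G}"
    unfolding gen tensor_square_def by (rule presented_group_generated)
  show ?thesis
  proof unfold_locales
    fix g h assume gh: "g \<in> carrier G" "h \<in> carrier G"
    then show "tensor G g h \<in> carrier (tensor_square G)"
      unfolding carrier by (auto intro: generate.incl)
    show "tensor_commutator G (tensor G g h) = commutator G g h"
      using gh by (rule tensor_commutator_tensor)
    fix g' assume g': "g' \<in> carrier G"
    have "([((g \<otimes> g', h), True)], [((conj_by G g g', conj_by G g h), True), ((g, h), True)]) \<in> tensor_relations G"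
      using gh g' unfolding tensor_relations_def by blast
    then show "tensor G (g \<otimes> g') h = tensor G (conj_by G g g') (conj_by G g h) \<otimes>\<^bsub>tensor_square G\<^esub> tensor G g h"
      using gh g' by (subst tensor_mult_tensor) (simp_all add: tensor_def presented_gen_def tensor_relation_class)
  next
    fix g h h' assume gh: "g \<in> carrier G" "h \<in> carrier G" "h' \<in> carrier G"
    have "([((g, h \<otimes> h'), True)], [((g, h), True), ((conj_by G h g, conj_by G h h'), True)]) \<in> tensor_relations G"
      using gh unfolding tensor_relations_def by blast
    then show "tensor G g (h \<otimes> h') = tensor G g h \<otimes>\<^bsub>tensor_square G\<^esub> tensor G (conj_by G h g) (conj_by G h h')"
      using gh by (subst tensor_mult_tensor) (simp_all add: tensor_def presented_gen_def tensor_relation_class)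
  qed (rule tensor_commutator_hom carrier)+
qed

end

section \<open>Antisymmetric pairings and their diagonal\<close>

context commutator_pairing
begin

context
  assumes antisymmetric: "\<And>x y. x \<in> carrier G \<Longrightarrow> y \<in> carrier G \<Longrightarrow> w x y \<otimes>\<^bsub>L\<^esub> w y x = \<one>\<^bsub>L\<^esub>"
begin

lemma w_diagonal_kernel: "x \<in> carrier G \<Longrightarrow> w x x \<in> kernel L G d"
  by (simp add: kernel_def G.commutator_eq(2))

text \<open>Diagonal values are central and invariant under conjugation. In the expansion of the
  pairing of x y with itself they can thus be gathered, and the two cross terms cancel by
  antisymmetry.\<close>

lemma w_diagonal_hom: "(\<lambda>x. w x x) \<in> hom G L"
proof (rule homI)
  fix x y assume x: "x \<in> carrier G" and y: "y \<in> carrier G"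
  let ?b = "conj_by G x y"
  have "w (x \<otimes>\<^bsub>G\<^esub> y) (x \<otimes>\<^bsub>G\<^esub> y) = w ?b (x \<otimes>\<^bsub>G\<^esub> ?b) \<otimes>\<^bsub>L\<^esub> w x (x \<otimes>\<^bsub>G\<^esub> y)"
    using x y by (subst w_mult_left) (simp_all add: G.conj_by_mult_right)
  also have "w ?b (x \<otimes>\<^bsub>G\<^esub> ?b) = w ?b x \<otimes>\<^bsub>L\<^esub> w y y"
    using x y w_diagonal_conj[of ?b x] w_diagonal_conj[of y x] by (simp add: w_mult_right)
  also have "w x (x \<otimes>\<^bsub>G\<^esub> y) = w x x \<otimes>\<^bsub>L\<^esub> w x ?b"
    using x y by (simp add: w_mult_right)
  also have "w ?b x \<otimes>\<^bsub>L\<^esub> w y y \<otimes>\<^bsub>L\<^esub> (w x x \<otimes>\<^bsub>L\<^esub> w x ?b) = w ?b x \<otimes>\<^bsub>L\<^esub> (w y y \<otimes>\<^bsub>L\<^esub> w x x) \<otimes>\<^bsub>L\<^esub> w x ?b"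
    using x y by (simp add: L.m_assoc)
  also have "w y y \<otimes>\<^bsub>L\<^esub> w x x = w x x \<otimes>\<^bsub>L\<^esub> w y y"
    using x y by (intro kernel_central w_diagonal_kernel) simp_all
  also have "w ?b x \<otimes>\<^bsub>L\<^esub> (w x x \<otimes>\<^bsub>L\<^esub> w y y) = w x x \<otimes>\<^bsub>L\<^esub> w y y \<otimes>\<^bsub>L\<^esub> w ?b x"
    using x y d.subgroup_kernel
    by (intro kernel_central[symmetric] subgroup.m_closed[of _ L] w_diagonal_kernel) simp_all
  also have "w x x \<otimes>\<^bsub>L\<^esub> w y y \<otimes>\<^bsub>L\<^esub> w ?b x \<otimes>\<^bsub>L\<^esub> w x ?b = w x x \<otimes>\<^bsub>L\<^esub> w y y"
    using x y by (simp add: L.m_assoc antisymmetric)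
  finally show "w (x \<otimes>\<^bsub>G\<^esub> y) (x \<otimes>\<^bsub>G\<^esub> y) = w x x \<otimes>\<^bsub>L\<^esub> w y y" .
qed simp

text \<open>Dividing out the diagonal values, a subgroup by \<open>w_diagonal_hom\<close>, leaves an
  alternating pairing subject to \<open>card_kernel_le\<close>. Each element of the new kernel is a
  coset of that subgroup, and these cosets cover the old kernel.\<close>

lemma card_kernel_antisymmetric_le:
  fixes n :: nat and p a :: "nat \<Rightarrow> nat"
  assumes fin: "finite (carrier G)"
    and p: "\<And>i. i < n \<Longrightarrow> Factorial_Ring.prime (p i)" and inj: "inj_on p {..<n}"
    and ord: "order G = (\<Prod>i<n. p i ^ a i)"
  shows "finite (kernel L G d)"
    and "card (kernel L G d)
      \<le> card ((\<lambda>x. w x x) ` carrier G) * (\<Prod>i<n. p i ^ (a i * (a i - 1) div 2))"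
proof -
  let ?N = "(\<lambda>x. w x x) ` carrier G"
  interpret s: group_hom G L "\<lambda>x. w x x"
    by (intro group_hom.intro group_hom_axioms.intro w_diagonal_hom G.group_axioms L.group_axioms)
  have N: "subgroup ?N L" by (rule s.img_is_subgroup)
  interpret N: subgroup ?N L by (rule N)
  have NK: "?N \<subseteq> kernel L G d" using w_diagonal_kernel by blast
  obtain d' where q: "commutator_pairing G (L Mod ?N) (\<lambda>g h. ?N #>\<^bsub>L\<^esub> w g h) d'"
    and d': "\<And>t. t \<in> carrier L \<Longrightarrow> d' (?N #>\<^bsub>L\<^esub> t) = d t"
    using quotient[OF N NK] by blast
  interpret q: commutator_pairing G "L Mod ?N" "\<lambda>g h. ?N #>\<^bsub>L\<^esub> w g h" d' by (rule q)
  interpret q: alternating_commutator_pairing G "L Mod ?N" "\<lambda>g h. ?N #>\<^bsub>L\<^esub> w g h" d'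
  proof unfold_locales
    fix x assume "x \<in> carrier G"
    then have "w x x \<in> ?N" by blast
    then show "?N #>\<^bsub>L\<^esub> w x x = \<one>\<^bsub>L Mod ?N\<^esub>" using N.rcos_const[OF L.group_axioms] by simp
  qed
  let ?K = "kernel (L Mod ?N) G d'"
  note K = q.card_kernel_le[OF fin p inj ord]
  have sub: "kernel L G d \<subseteq> \<Union>?K"
  proof
    fix t assume t: "t \<in> kernel L G d"
    then have "?N #>\<^bsub>L\<^esub> t \<in> ?K" by (auto simp: kernel_def carrier_FactGroup d')
    moreover have "t \<in> ?N #>\<^bsub>L\<^esub> t" using t N by (intro L.rcos_self) (simp_all add: kernel_def)
    ultimately show "t \<in> \<Union>?K" by (rule UnionI)
  qed
  have finN: "finite ?N" using fin by simp
  have coset: "finite C" "card C = card ?N" if "C \<in> ?K" for C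
  proof -
    have "C \<in> rcosets\<^bsub>L\<^esub> ?N" using that by (simp add: kernel_def FactGroup_def)
    then show "finite C" "card C = card ?N"
      using L.card_rcosets_equal[OF _ N.subset] L.rcosets_finite[OF _ N.subset finN] by simp_all
  qed
  have finU: "finite (\<Union>?K)" using K(1) coset(1) by (rule finite_Union)
  with sub show "finite (kernel L G d)" by (rule finite_subset)
  have "card (kernel L G d) \<le> card (\<Union>?K)" using finU sub by (rule card_mono)
  also have "\<dots> \<le> (\<Sum>C\<in>?K. card C)" by (rule card_Union_le_sum_card)
  also have "\<dots> = card ?N * card ?K" by (simp add: coset(2) cong: sum.cong)
  also have "\<dots> \<le> card ?N * (\<Prod>i<n. p i ^ (a i * (a i - 1) div 2))"
    using K(2) by (rule mult_le_mono2)
  finally show "card (kernel L G d) \<le> card ?N * (\<Prod>i<n. p i ^ (a i * (a i - 1) div 2))" .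
qed

end

end

text \<open>Modulo an odd \<open>n\<close> every element is a double; modulo an even
  \<open>n\<close> parity is well defined and is the only obstruction.\<close>

lemma integer_mod_group_half_difference:
  assumes v: "v \<in> carrier (integer_mod_group n)" and v': "v' \<in> carrier (integer_mod_group n)" and n: "n > 0"
    and parity: "even n \<Longrightarrow> even v \<longleftrightarrow> even v'"
  shows "\<exists>c\<in>carrier (integer_mod_group n). v = v' \<otimes>\<^bsub>integer_mod_group n\<^esub> c \<otimes>\<^bsub>integer_mod_group n\<^esub> c"
proof -
  have "\<exists>q. v mod int n = (v' + 2 * q) mod int n"
  proof (cases "even n")
    case True
    then have "v = v' + 2 * ((v - v') div 2)" using parity by simp
    then show ?thesis by metis
  next
    case False
    then obtain b where b: "n = 2 * b + 1" by (elim oddE)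
    \<comment> \<open>\<open>b + 1\<close> is the inverse of 2 modulo
      \<open>n = 2 * b + 1\<close>.\<close>
    have "v' + 2 * ((v - v') * (int b + 1)) = v + (v - v') * int n"
      by (simp add: b algebra_simps)
    then have "v mod int n = (v' + 2 * ((v - v') * (int b + 1))) mod int n" by simp
    then show ?thesis by blast
  qed
  then obtain q where q: "v mod int n = (v' + 2 * q) mod int n" by blast
  have "v = v mod int n" using v n by (simp add: carrier_integer_mod_group)
  moreover have "((v' + q mod int n) mod int n + q mod int n) mod int n = (v' + q + q) mod int n"
    by (simp only: mod_simps)
  ultimately show ?thesis
    using n q by (intro bexI[of _ "q mod int n"]) (simp_all add: carrier_integer_mod_group add.commute)
qed

text \<open>\<open>s\<close> factors through the abelianization and kills squares, so
  \<open>s g\<close> depends only on the parities of the coordinates of \<open>g\<close> on which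
  doubling is not onto: the \<open>r\<close> infinite ones and those with even
  \<open>d j\<close>.\<close>

lemma card_exponent_two_image_le:
  fixes G :: "('a, 'b) monoid_scheme" and L :: "('c, 'e) monoid_scheme" and r m :: nat and d :: "nat \<Rightarrow> nat"
  assumes G: "group G" and L: "group L" and s: "s \<in> hom G L"
    and two: "\<And>g. g \<in> carrier G \<Longrightarrow> s g \<otimes>\<^bsub>L\<^esub> s g = \<one>\<^bsub>L\<^esub>"
    and d: "\<And>j. j < m \<Longrightarrow> d j > 0"
    and iso: "abelianization G \<cong>
           product_group {..<r} (\<lambda>_. integer_group)
           \<times>\<times> product_group {..<m} (\<lambda>j. integer_mod_group (d j))"
  shows "card (s ` carrier G) \<le> 2 ^ (r + card {j. j < m \<and> even (d j)})"
proof -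
  interpret s: group_hom G L s using G L s by (intro group_hom.intro group_hom_axioms.intro)
  let ?D = "derived G (carrier G)" and ?J = "{j. j < m \<and> even (d j)}"
  let ?A = "product_group {..<r} (\<lambda>_. integer_group) \<times>\<times> product_group {..<m} (\<lambda>j. integer_mod_group (d j))"
  interpret D: normal ?D G by (rule s.G.derived_self_is_normal)
  have inv_s: "inv\<^bsub>L\<^esub> s g = s g" if "g \<in> carrier G" for g
    using that by (intro s.H.inv_equality) (simp_all add: two)
  have "derived_set G (carrier G) \<subseteq> kernel G L s"
  proof clarify
    fix g h assume "g \<in> carrier G" "h \<in> carrier G"
    then show "g \<otimes>\<^bsub>G\<^esub> h \<otimes>\<^bsub>G\<^esub> inv\<^bsub>G\<^esub> g \<otimes>\<^bsub>G\<^esub> inv\<^bsub>G\<^esub> h \<in> kernel G L s"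
      using two[of "g \<otimes>\<^bsub>G\<^esub> h"] by (simp add: kernel_def inv_s s.H.m_assoc)
  qed
  then have kills: "?D \<subseteq> kernel G L s"
    unfolding derived_def by (rule s.G.generate_subgroup_incl[OF _ s.subgroup_kernel])
  have s_coset: "s g = s h" if "g \<in> carrier G" "h \<in> carrier G" "?D #>\<^bsub>G\<^esub> g = ?D #>\<^bsub>G\<^esub> h" for g h
  proof -
    have "g \<in> ?D #>\<^bsub>G\<^esub> h" using that s.G.rcos_self[OF that(1) D.subgroup_axioms] by simp
    then obtain x where "x \<in> ?D" "g = x \<otimes>\<^bsub>G\<^esub> h" by (auto simp: r_coset_def)
    then show ?thesis using kills that(2) by (auto simp: kernel_def)
  qed
  obtain \<phi> where \<phi>: "\<phi> \<in> iso (G Mod ?D) ?A"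
    using iso by (auto simp: is_iso_def abelianization_def)
  then have hom: "\<phi> \<in> hom (G Mod ?D) ?A" and bij: "bij_betw \<phi> (carrier (G Mod ?D)) (carrier ?A)"
    by (simp_all add: iso_def)
  define F where "F g = \<phi> (?D #>\<^bsub>G\<^esub> g)" for g
  have F_closed: "F g \<in> carrier ?A" if "g \<in> carrier G" for g
    unfolding F_def using hom that by (intro hom_in_carrier[OF hom]) (auto simp: carrier_FactGroup)
  have F_mult: "F (g \<otimes>\<^bsub>G\<^esub> h) = F g \<otimes>\<^bsub>?A\<^esub> F h" if "g \<in> carrier G" "h \<in> carrier G" for g h
    using hom_mult[OF hom, of "?D #>\<^bsub>G\<^esub> g" "?D #>\<^bsub>G\<^esub> h"] that
    by (simp add: F_def carrier_FactGroup D.rcos_sum)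
  have F_inj: "s g = s h" if "g \<in> carrier G" "h \<in> carrier G" "F g = F h" for g h
    using s_coset[OF that(1,2)] that bij
    by (auto simp: F_def bij_betw_def inj_on_def carrier_FactGroup)
  have F_onto: "\<exists>g\<in>carrier G. F g = y" if "y \<in> carrier ?A" for y
    using that bij unfolding bij_betw_def F_def carrier_FactGroup by (metis (no_types, lifting) imageE)
  define par where "par g = (\<lambda>i\<in>{..<r}. even (fst (F g) i), \<lambda>j\<in>?J. even (snd (F g) j))" for g
  have par: "s g = s h" if g: "g \<in> carrier G" and h: "h \<in> carrier G" and eq: "par g = par h" for g h
  proof -
    obtain u v where uv: "F g = (u, v)" by (cases "F g")
    obtain u' v' where uv': "F h = (u', v')" by (cases "F h")
    have ext: "u \<in> extensional {..<r}" "u' \<in> extensional {..<r}" "v \<in> extensional {..<m}" "v' \<in> extensional {..<m}"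
      and vj: "\<And>j. j < m \<Longrightarrow> v j \<in> carrier (integer_mod_group (d j))" "\<And>j. j < m \<Longrightarrow> v' j \<in> carrier (integer_mod_group (d j))"
      using F_closed[OF g] F_closed[OF h] by (auto simp: uv uv' DirProd_def PiE_iff)
    have even_u: "even (u i) \<longleftrightarrow> even (u' i)" if "i < r" for i
      using fun_cong[OF arg_cong[OF eq, of fst], of i] that by (simp add: par_def uv uv')
    have even_v: "even (v j) \<longleftrightarrow> even (v' j)" if "j < m" "even (d j)" for j
      using fun_cong[OF arg_cong[OF eq, of snd], of j] that by (simp add: par_def uv uv')
    have "\<exists>c. \<forall>j<m. c j \<in> carrier (integer_mod_group (d j)) \<and>
        v j = v' j \<otimes>\<^bsub>integer_mod_group (d j)\<^esub> c j \<otimes>\<^bsub>integer_mod_group (d j)\<^esub> c j"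
      using integer_mod_group_half_difference[OF vj d even_v] by metis
    then obtain c where c: "\<And>j. j < m \<Longrightarrow> c j \<in> carrier (integer_mod_group (d j))"
      "\<And>j. j < m \<Longrightarrow> v j = v' j \<otimes>\<^bsub>integer_mod_group (d j)\<^esub> c j \<otimes>\<^bsub>integer_mod_group (d j)\<^esub> c j"
      by blast
    \<comment> \<open>Half the difference of the coordinates of \<open>g\<close> and
      \<open>h\<close>; a preimage \<open>x\<close> of it makes \<open>g\<close> and h x x agree
      under \<open>F\<close>.\<close>
    let ?y = "(\<lambda>i\<in>{..<r}. (u i - u' i) div 2, \<lambda>j\<in>{..<m}. c j)"
    have "?y \<in> carrier ?A" using c(1) by (auto simp: DirProd_def)
    then obtain x where x: "x \<in> carrier G" "F x = ?y" using F_onto by blast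
    have "u = (\<lambda>i\<in>{..<r}. (\<lambda>i\<in>{..<r}. u' i + fst ?y i) i + fst ?y i)"
      using ext(1) even_u by (intro extensionalityI[of _ "{..<r}"]) auto
    moreover have "v = (\<lambda>j\<in>{..<m}. (\<lambda>j\<in>{..<m}. v' j \<otimes>\<^bsub>integer_mod_group (d j)\<^esub> c j) j \<otimes>\<^bsub>integer_mod_group (d j)\<^esub> c j)"
      using ext(3) c(2) by (intro extensionalityI[of _ "{..<m}"]) auto
    ultimately have "F g = F (h \<otimes>\<^bsub>G\<^esub> x \<otimes>\<^bsub>G\<^esub> x)"
      using h x by (simp add: F_mult uv uv' cong: restrict_cong)
    then have "s g = s (h \<otimes>\<^bsub>G\<^esub> x \<otimes>\<^bsub>G\<^esub> x)" using g h x by (intro F_inj) simp_all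
    also have "\<dots> = s h" using h x by (simp add: s.H.m_assoc two)
    finally show ?thesis .
  qed
  have fin: "finite (par ` carrier G)" and card: "card (par ` carrier G) \<le> 2 ^ (r + card ?J)"
  proof -
    let ?B = "PiE {..<r} (\<lambda>_. UNIV :: bool set) \<times> PiE ?J (\<lambda>_. UNIV :: bool set)"
    have sub: "par ` carrier G \<subseteq> ?B" by (auto simp: par_def)
    have finB: "finite ?B" by (intro finite_cartesian_product finite_PiE) auto
    show "finite (par ` carrier G)" using sub finB by (rule finite_subset)
    have "card (par ` carrier G) \<le> card ?B" using finB sub by (rule card_mono)
    also have "card ?B = 2 ^ (r + card ?J)"
      by (simp add: card_cartesian_product card_PiE power_add)
    finally show "card (par ` carrier G) \<le> 2 ^ (r + card ?J)" .
  qed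
  \<comment> \<open>Choosing one \<open>g\<close> for each parity pattern shows that
    \<open>s\<close> takes no more values than \<open>par\<close>.\<close>
  have eq: "s ` carrier G = (\<lambda>P. s (SOME g. g \<in> carrier G \<and> par g = P)) ` (par ` carrier G)"
  proof -
    have "s (SOME h. h \<in> carrier G \<and> par h = par g) = s g" if "g \<in> carrier G" for g
    proof -
      let ?h = "SOME h. h \<in> carrier G \<and> par h = par g"
      have "?h \<in> carrier G \<and> par ?h = par g" by (rule someI[of _ g]) (simp add: that)
      then show ?thesis using par that by blast
    qed
    then show ?thesis by (simp add: image_image cong: image_cong_simp)
  qed
  have "card (s ` carrier G) \<le> card (par ` carrier G)"
    by (subst eq) (rule card_image_le[OF fin])
  with card show ?thesis by simp
qed

theorem corollary5p7:
  fixes G :: "('a, 'b) monoid_scheme"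
    and n r m k :: nat and p a d :: "nat \<Rightarrow> nat"
  assumes "group G" and "finite (carrier G)"
    and "\<And>i. i < n \<Longrightarrow> Factorial_Ring.prime (p i)" and "inj_on p {..<n}"
    and "Coset.order G = (\<Prod>i<n. p i ^ a i)"
    and "\<And>j. j < m \<Longrightarrow> d j > 0"
    and "abelianization G \<cong>
           product_group {..<r} (\<lambda>_. integer_group)
           \<times>\<times> product_group {..<m} (\<lambda>j. integer_mod_group (d j))"
    and "k = card {j. j < m \<and> even (d j)}"
  shows "finite (carrier (pi2_stable_K1 G)) \<and>
         card (carrier (pi2_stable_K1 G)) \<le> 2 ^ (r + k) * (\<Prod>i<n. p i ^ (a i * (a i - 1) div 2))"
proof -
  let ?T = "tensor_square G" and ?D = "tensor_Delta G"
  interpret group G by fact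
  interpret T: commutator_pairing G ?T "tensor G" "tensor_commutator G"
    by (rule commutator_pairing_tensor)
  let ?gens = "{tensor G x y \<otimes>\<^bsub>?T\<^esub> tensor G y x | x y. x \<in> carrier G \<and> y \<in> carrier G}"
  have gens: "?gens \<subseteq> kernel ?T G (tensor_commutator G)"
  proof clarify
    fix x y assume xy: "x \<in> carrier G" "y \<in> carrier G"
    then have "commutator G x y \<otimes>\<^bsub>G\<^esub> commutator G y x = \<one>\<^bsub>G\<^esub>"
      using commutator_self_inverse[of x y] commutator_closed[of x y] by (metis r_inv)
    then show "tensor G x y \<otimes>\<^bsub>?T\<^esub> tensor G y x \<in> kernel ?T G (tensor_commutator G)"
      using xy by (simp add: kernel_def)
  qed
  have sub: "subgroup ?D ?T"
    unfolding tensor_Delta_def using gens by (intro T.L.generate_is_subgroup) (auto simp: kernel_def)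
  have ker: "?D \<subseteq> kernel ?T G (tensor_commutator G)"
    unfolding tensor_Delta_def using gens by (rule T.L.generate_subgroup_incl[OF _ T.d.subgroup_kernel])
  let ?L = "?T Mod ?D" and ?w = "\<lambda>g h. ?D #>\<^bsub>?T\<^esub> tensor G g h"
  obtain e where q: "commutator_pairing G ?L ?w e"
    and e: "\<And>t. t \<in> carrier ?T \<Longrightarrow> e (?D #>\<^bsub>?T\<^esub> t) = tensor_commutator G t"
    using T.quotient[OF sub ker] by blast
  interpret q: commutator_pairing G ?L ?w e by (rule q)
  interpret D: normal ?D ?T using sub ker by (rule T.kernel_subgroup_normal)
  \<comment> \<open>The generators of Delta(G) are exactly what antisymmetry requires to
    vanish.\<close>
  have anti: "?w x y \<otimes>\<^bsub>?L\<^esub> ?w y x = \<one>\<^bsub>?L\<^esub>" if "x \<in> carrier G" "y \<in> carrier G" for x y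
  proof -
    have "tensor G x y \<otimes>\<^bsub>?T\<^esub> tensor G y x \<in> ?D"
      using that unfolding tensor_Delta_def by (intro generate.incl) blast
    then show ?thesis using that by (simp add: D.rcos_sum D.rcos_const T.L.group_axioms)
  qed
  \<comment> \<open>J(G)/Delta(G) is the kernel of the commutator map induced on the tensor square
    modulo Delta(G).\<close>
  have "carrier (pi2_stable_K1 G) = kernel ?L G e"
    by (auto simp: pi2_stable_K1_def tensor_J_def kernel_def carrier_FactGroup e)
  \<comment> \<open>\<open>anti\<close> at equal arguments says that diagonal values have trivial
    squares, which is the exponent two hypothesis.\<close>
  moreover have N: "card ((\<lambda>x. ?w x x) ` carrier G) \<le> 2 ^ (r + k)"
    unfolding assms(8)
    using assms(1) q.L.group_axioms q.w_diagonal_hom[OF anti] anti assms(6,7)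
    by (rule card_exponent_two_image_le)
  moreover note K = q.card_kernel_antisymmetric_le[OF anti assms(2-5)]
  ultimately show ?thesis using order_trans[OF K(2) mult_le_mono1[OF N]] by simp
qed

end
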